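(* Fix an integer $d\ge 2$. For every $k\in\mathbb{N}=\{1,2,\dots\}$ and every $p\in[0,1]$, the strict inequality $q_c(p,k+1) < q_c(p,k)$ holds unless $q_c(p,k)=0$.
   Context: Let $[d]=\{1,\dots,d\}$ and $[d]_\star=\bigcup_{n\ge 0}[d]^n$ (finite sequences, $[d]^0=\{o\}$ with $o$ the empty sequence), with concatenation $u\cdot v$. For $k\in\mathbb{N}$, $\mathbb{T}_{d,k}$ is the oriented graph with vertex set $[d]_\star$ and oriented edges $\langle u,u\cdot a\rangle$ for $u\in[d]_\star$, $a\in[d]$ ("short edges") and $\langle u,u\cdot r\rangle$ for $u\in[d]_\star$, $r\in[d]^k$ ("long edges"). Under $\mathbb{P}_{p,q}$, independently, each short edge is open with probability $p$ and each long edge is open with probability $q$. The event $o\leadsto\infty$ means that there are infinitely many vertices $v$ reachable from $o$ by a path $o=u^0,u^1,\dots,u^n=v$ with each oriented edge $\langle u^j,u^{j+1}\rangle$ open. Let $\mathcal{P}_k=\{(p,q)\in[0,1]^2:\mathbb{P}_{p,q}(o\leadsto\infty)>0\}$ (computed on $\mathbb{T}_{d,k}$) and $q_c(p,k)=\inf\{q:(p,q)\in\mathcal{P}_k\}$. *)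

theory Defs
  imports "HOL-Probability.Probability"
begin

text \<open>Vertices of the tree: finite sequences over [d] = {1..d}, encoded as nat lists
  with entries in {1..d}; the root o is the empty list, concatenation is (@).\<close>

datatype edge = Short "nat list" nat | Long "nat list" "nat list"

definition vertices :: "nat \<Rightarrow> nat list set" where
  "vertices d = lists {1..d}"

text \<open>Oriented edge set of T_{d,k}: short edges <u, u.a>, long edges <u, u.r> with |r| = k.\<close>
definition edges :: "nat \<Rightarrow> nat \<Rightarrow> edge set" where
  "edges d k = {Short u a | u a. u \<in> vertices d \<and> a \<in> {1..d}}
             \<union> {Long u r | u r. u \<in> vertices d \<and> r \<in> lists {1..d} \<and> length r = k}"

definition edge_prob :: "real \<Rightarrow> real \<Rightarrow> edge \<Rightarrow> real" where
  "edge_prob p q e = (case e of Short _ _ \<Rightarrow> p | Long _ _ \<Rightarrow> q)"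

definition perc_measure :: "nat \<Rightarrow> nat \<Rightarrow> real \<Rightarrow> real \<Rightarrow> (edge \<Rightarrow> bool) measure" where
  "perc_measure d k p q = PiM (edges d k) (\<lambda>e. measure_pmf (bernoulli_pmf (edge_prob p q e)))"

definition open_rel :: "nat \<Rightarrow> nat \<Rightarrow> (edge \<Rightarrow> bool) \<Rightarrow> (nat list \<times> nat list) set" where
  "open_rel d k \<omega> =
     {(u, u @ [a]) | u a. Short u a \<in> edges d k \<and> \<omega> (Short u a)}
   \<union> {(u, u @ r) | u r. Long u r \<in> edges d k \<and> \<omega> (Long u r)}"

definition percolates :: "nat \<Rightarrow> nat \<Rightarrow> (edge \<Rightarrow> bool) \<Rightarrow> bool" where
  "percolates d k \<omega> \<longleftrightarrow> infinite {v. ([], v) \<in> (open_rel d k \<omega>)\<^sup>*}"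

definition perc_prob :: "nat \<Rightarrow> nat \<Rightarrow> real \<Rightarrow> real \<Rightarrow> real" where
  "perc_prob d k p q = measure (perc_measure d k p q)
      {\<omega> \<in> space (perc_measure d k p q). percolates d k \<omega>}"

definition perc_region :: "nat \<Rightarrow> nat \<Rightarrow> (real \<times> real) set" where
  "perc_region d k = {(p, q). 0 \<le> p \<and> p \<le> 1 \<and> 0 \<le> q \<and> q \<le> 1 \<and> perc_prob d k p q > 0}"

definition q_c :: "nat \<Rightarrow> real \<Rightarrow> nat \<Rightarrow> real" where
  "q_c d p k = Inf {q. (p, q) \<in> perc_region d k}"

end

(* Along a ray of the tree, record which of the last k vertices are reachable: this gives a
   k-bit state, the d children of a vertex evolve independently given its state, and so
   percolation is survival of a multi-type branching process. The limit v of its survival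
   probabilities satisfies v <= d * (one-step average of v).

   A (k+1)-bit state with an inserted 0 can imitate the k-bit process. A step that merely
   moves the inserted 0 past the newest bit costs time but no probability, and in the tree
   this free level multiplies the population by d. The inserted 0 fails to be passed only as long
   as short edges keep succeeding, which for p < 1 ends with positive probability at each step.
   So weighting v by the position of the inserted 0 gives a function whose weighted average
   grows by a factor > 1 for k+1, with slack left to decrease q below q_c(p,k). *)

theory Submission
  imports Defs
begin

subsection \<open>Survival probabilities of the branching process\<close>

text \<open>The infimum \<open>q\<^sub>0 = q_c d p k\<close> need not be attained, so there may be
  no surviving process at \<open>q\<^sub>0\<close> itself to compare with. The comparison therefore
  starts from some \<open>q\<close> slightly above \<open>q\<^sub>0\<close> and has to end below
  \<open>q\<^sub>0\<close>, with a gain fixed before \<open>q\<close> is known. For this reason the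
  constant \<open>c\<close>, which bounds from below what is left of \<open>v\<close> after a failed
  short edge, depends only on \<open>p\<close>, \<open>q\<^sub>0\<close> and \<open>k\<close>. The
  gain is a factor \<open>t ^ 3\<close> per level. One \<open>t\<close> pays for the concavity of
  \<open>1 - (1 - y) ^ d\<close>, the other two for lowering \<open>q < t * q\<^sub>0\<close> to
  \<open>q\<^sub>0 / t\<close>. The limit \<open>v\<close> takes the place of a principal
  eigenvector. It is at most 1 and vanishes on the dead state, so a small multiple of it lies below
  the survival probability at generation 0, where the induction over generations starts.\<close>

text \<open>A state lists the reachability of the last k vertices of a ray, newest first. Its head
  governs the next short edge and its last entry the next long edge.\<close>

definition wet_prob :: "real \<Rightarrow> real \<Rightarrow> bool list \<Rightarrow> real" where
  "wet_prob p q \<eta> = 1 - (1 - (if hd \<eta> then p else 0)) * (1 - (if last \<eta> then q else 0))"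

definition avg :: "real \<Rightarrow> real \<Rightarrow> (bool list \<Rightarrow> real) \<Rightarrow> bool list \<Rightarrow> real" where
  "avg p q f \<eta> = wet_prob p q \<eta> * f (True # butlast \<eta>)
     + (1 - wet_prob p q \<eta>) * f (False # butlast \<eta>)"

text \<open>Survival for \<open>n\<close> generations as a purely analytic recursion;
  \<open>prob_alive\<close> later identifies it with a percolation probability.\<close>

primrec surv :: "nat \<Rightarrow> real \<Rightarrow> real \<Rightarrow> nat \<Rightarrow> bool list \<Rightarrow> real" where
  "surv d p q 0 \<eta> = (if True \<in> set \<eta> then 1 else 0)"
| "surv d p q (Suc n) \<eta> = 1 - (1 - avg p q (surv d p q n) \<eta>) ^ d"

abbreviation state_le :: "bool list \<Rightarrow> bool list \<Rightarrow> bool" (infix "\<preceq>" 50) where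
  "\<eta> \<preceq> \<zeta> \<equiv> list_all2 (\<longrightarrow>) \<eta> \<zeta>"

lemma state_le_refl: "\<eta> \<preceq> \<eta>"
  by (simp add: list_all2_refl)

lemma state_le_butlast: "\<eta> \<preceq> \<zeta> \<Longrightarrow> butlast \<eta> \<preceq> butlast \<zeta>"
  by (simp add: butlast_conv_take list_all2_lengthD list_all2_takeI)

lemma state_le_ends:
  assumes "\<eta> \<preceq> \<zeta>" "\<eta> \<noteq> []"
  shows "hd \<eta> \<Longrightarrow> hd \<zeta>" "last \<eta> \<Longrightarrow> last \<zeta>"
proof -
  have "\<zeta> \<noteq> []" and len: "length \<eta> = length \<zeta>" using assms by (auto dest: list_all2_lengthD)
  then show "hd \<eta> \<Longrightarrow> hd \<zeta>" "last \<eta> \<Longrightarrow> last \<zeta>"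
    using assms list_all2_nthD[OF assms(1), of 0] list_all2_nthD[OF assms(1), of "length \<eta> - 1"]
    by (auto simp: hd_conv_nth last_conv_nth)
qed

lemma state_le_True: "\<eta> \<preceq> \<zeta> \<Longrightarrow> True \<in> set \<eta> \<Longrightarrow> True \<in> set \<zeta>"
  by (induction rule: list_all2_induct) auto

context
  fixes p q :: real
  assumes pq: "0 \<le> p" "p \<le> 1" "0 \<le> q" "q \<le> 1"
begin

lemma wet_prob_bounds: "0 \<le> wet_prob p q \<eta>" "wet_prob p q \<eta> \<le> 1"
proof -
  have "(1 - (if hd \<eta> then p else 0)) * (1 - (if last \<eta> then q else 0)) \<le> 1 * 1"
    using pq by (intro mult_mono) auto
  then show "0 \<le> wet_prob p q \<eta>" by (simp add: wet_prob_def)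
  show "wet_prob p q \<eta> \<le> 1" using pq by (simp add: wet_prob_def)
qed

lemma wet_prob_mono:
  assumes "\<eta> \<preceq> \<zeta>" "\<eta> \<noteq> []"
  shows "wet_prob p q \<eta> \<le> wet_prob p q \<zeta>"
  unfolding wet_prob_def using pq state_le_ends[OF assms]
  by (intro diff_left_mono mult_mono) auto

text \<open>A larger weight on the update by True helps only if \<open>g\<close> prefers that
  update, hence the last premise.\<close>

lemma avg_mono:
  assumes "wet_prob p q \<eta> \<le> wet_prob p q \<zeta>"
    and "f (True # butlast \<eta>) \<le> g (True # butlast \<zeta>)"
    and "f (False # butlast \<eta>) \<le> g (False # butlast \<zeta>)"
    and "g (False # butlast \<zeta>) \<le> g (True # butlast \<zeta>)"
  shows "avg p q f \<eta> \<le> avg p q g \<zeta>"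
proof -
  let ?a = "wet_prob p q \<eta>" and ?b = "wet_prob p q \<zeta>"
  have "avg p q f \<eta> \<le> ?a * g (True # butlast \<zeta>) + (1 - ?a) * g (False # butlast \<zeta>)"
    unfolding avg_def using wet_prob_bounds assms by (intro add_mono mult_left_mono) auto
  also have "\<dots> = g (False # butlast \<zeta>) + ?a * (g (True # butlast \<zeta>) - g (False # butlast \<zeta>))"
    by (simp add: algebra_simps)
  also have "\<dots> \<le> g (False # butlast \<zeta>) + ?b * (g (True # butlast \<zeta>) - g (False # butlast \<zeta>))"
    using assms by (intro add_left_mono mult_right_mono) auto
  also have "\<dots> = avg p q g \<zeta>" by (simp add: avg_def algebra_simps)
  finally show ?thesis .
qed

lemma avg_nonneg:
  assumes "\<And>b. 0 \<le> f (b # butlast \<eta>)"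
  shows "0 \<le> avg p q f \<eta>"
  unfolding avg_def using assms wet_prob_bounds by (intro add_nonneg_nonneg mult_nonneg_nonneg) auto

lemma avg_le:
  assumes "\<And>b. f (b # butlast \<eta>) \<le> c"
  shows "avg p q f \<eta> \<le> c"
  unfolding avg_def using assms wet_prob_bounds[of \<eta>] by (intro convex_bound_le) auto

lemma avg_ge:
  assumes "\<And>b. c \<le> f (b # butlast \<eta>)"
  shows "c \<le> avg p q f \<eta>"
  using avg_le[of "\<lambda>x. - f x" \<eta> "-c"] assms by (simp add: avg_def)

lemma surv_bounds: "0 \<le> surv d p q n \<eta> \<and> surv d p q n \<eta> \<le> 1"
proof (induction n arbitrary: \<eta>)
  case (Suc n)
  then have "0 \<le> avg p q (surv d p q n) \<eta>" "avg p q (surv d p q n) \<eta> \<le> 1"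
    by (auto intro: avg_nonneg avg_le)
  then show ?case by (auto intro: power_le_one)
qed simp

lemmas surv_nonneg = surv_bounds[THEN conjunct1] and surv_le_1 = surv_bounds[THEN conjunct2]

lemma avg_surv_bounds: "0 \<le> avg p q (surv d p q n) \<eta>" "avg p q (surv d p q n) \<eta> \<le> 1"
  by (auto intro: avg_nonneg avg_le surv_nonneg surv_le_1)

lemma surv_mono: "\<eta> \<preceq> \<zeta> \<Longrightarrow> \<eta> \<noteq> [] \<Longrightarrow> surv d p q n \<eta> \<le> surv d p q n \<zeta>"
proof (induction n arbitrary: \<eta> \<zeta>)
  case 0
  then show ?case by (auto dest: state_le_True)
next
  case (Suc n)
  have "avg p q (surv d p q n) \<eta> \<le> avg p q (surv d p q n) \<zeta>"
    using Suc.prems by (intro avg_mono wet_prob_mono Suc.IH) (auto simp: state_le_butlast state_le_refl)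
  then show ?case using avg_surv_bounds by (auto intro!: power_mono)
qed

lemma surv_False: "True \<notin> set \<eta> \<Longrightarrow> \<eta> \<noteq> [] \<Longrightarrow> d > 0 \<Longrightarrow> surv d p q n \<eta> = 0"
proof (induction n arbitrary: \<eta>)
  case (Suc n)
  have *: "\<not> hd \<eta>" "\<not> last \<eta>" using Suc.prems by (metis hd_in_set, metis last_in_set)
  have "avg p q (surv d p q n) \<eta> = 0"
    using Suc.prems * Suc.IH[of "False # butlast \<eta>"]
    by (auto simp: avg_def wet_prob_def dest: in_set_butlastD)
  then show ?case by simp
qed simp

lemma surv_decseq: "\<eta> \<noteq> [] \<Longrightarrow> d > 0 \<Longrightarrow> surv d p q (Suc n) \<eta> \<le> surv d p q n \<eta>"
proof (induction n arbitrary: \<eta>)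
  case 0
  show ?case
  proof (cases "True \<in> set \<eta>")
    case False
    then show ?thesis using surv_False[OF False, of d 1] 0 by simp
  qed (use avg_surv_bounds(2)[of d 0 \<eta>] in simp)
next
  case (Suc n)
  have "avg p q (surv d p q (Suc n)) \<eta> \<le> avg p q (surv d p q n) \<eta>"
    using Suc by (intro avg_mono Suc.IH surv_mono) (auto simp: state_le_refl)
  then show ?case using avg_surv_bounds by (simp only: surv.simps(2)) (auto intro!: power_mono)
qed

text \<open>The sequence decreases, and its limit solves \<open>v = 1 - (1 - avg v) ^ d\<close>. Two
  linear consequences of this equation are passed on: the union bound over the \<open>d\<close>
  children, and the bound obtained by following a single child.\<close>

lemma surv_limit:
  assumes d: "d \<ge> 1"
  obtains v where "\<And>\<eta>. \<eta> \<noteq> [] \<Longrightarrow> (\<lambda>n. surv d p q n \<eta>) \<longlonglongrightarrow> v \<eta>"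
    and "\<And>\<eta>. 0 \<le> v \<eta>" "\<And>\<eta>. v \<eta> \<le> 1"
    and "\<And>\<eta> \<zeta>. \<eta> \<preceq> \<zeta> \<Longrightarrow> \<eta> \<noteq> [] \<Longrightarrow> v \<eta> \<le> v \<zeta>"
    and "\<And>\<eta>. True \<notin> set \<eta> \<Longrightarrow> \<eta> \<noteq> [] \<Longrightarrow> v \<eta> = 0"
    and "\<And>\<eta>. \<eta> \<noteq> [] \<Longrightarrow> v \<eta> \<le> d * avg p q v \<eta>"
    and "\<And>\<eta>. \<eta> \<noteq> [] \<Longrightarrow> avg p q v \<eta> \<le> v \<eta>"
proof -
  define v where "v \<eta> = (if \<eta> = [] then 0 else lim (\<lambda>n. surv d p q n \<eta>))" for \<eta>
  have conv: "(\<lambda>n. surv d p q n \<eta>) \<longlonglongrightarrow> v \<eta>" if "\<eta> \<noteq> []" for \<eta>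
  proof -
    have "decseq (\<lambda>n. surv d p q n \<eta>)" using surv_decseq that d by (intro decseq_SucI) auto
    then have "convergent (\<lambda>n. surv d p q n \<eta>)"
      using surv_nonneg decseq_convergent convergentI by metis
    then show ?thesis using that by (simp add: v_def convergent_LIMSEQ_iff)
  qed
  have fix_v: "v \<eta> = 1 - (1 - avg p q v \<eta>) ^ d" if "\<eta> \<noteq> []" for \<eta>
  proof -
    have "(\<lambda>n. avg p q (surv d p q n) \<eta>) \<longlonglongrightarrow> avg p q v \<eta>"
      unfolding avg_def by (intro tendsto_intros conv) auto
    then have "(\<lambda>n. surv d p q (Suc n) \<eta>) \<longlonglongrightarrow> 1 - (1 - avg p q v \<eta>) ^ d"
      by (simp only: surv.simps(2)) (intro tendsto_intros)
    then show ?thesis using LIMSEQ_Suc[OF conv[OF that]] LIMSEQ_unique by blast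
  qed
  have v0: "0 \<le> v \<eta>" for \<eta>
    using LIMSEQ_le_const[OF conv[of \<eta>], of 0] surv_nonneg by (cases "\<eta> = []") (auto simp: v_def)
  have v1: "v \<eta> \<le> 1" for \<eta>
    using LIMSEQ_le_const2[OF conv[of \<eta>], of 1] surv_le_1 by (cases "\<eta> = []") (auto simp: v_def)
  have a: "0 \<le> avg p q v \<eta>" "avg p q v \<eta> \<le> 1" for \<eta> by (auto intro: avg_nonneg avg_le v0 v1)
  show ?thesis
  proof (rule that[of v, OF conv v0 v1])
    fix \<eta> \<zeta> :: "bool list" assume "\<eta> \<preceq> \<zeta>" "\<eta> \<noteq> []"
    then show "v \<eta> \<le> v \<zeta>" using LIMSEQ_le[OF conv[of \<eta>] conv[of \<zeta>]] surv_mono by fastforce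
  next
    fix \<eta> :: "bool list" assume "True \<notin> set \<eta>" "\<eta> \<noteq> []"
    then show "v \<eta> = 0" using conv[of \<eta>] surv_False[of \<eta> d] d by (simp add: LIMSEQ_const_iff)
  next
    fix \<eta> :: "bool list" assume ne: "\<eta> \<noteq> []"
    have "1 + real d * (- avg p q v \<eta>) \<le> (1 + (- avg p q v \<eta>)) ^ d"
      using a by (intro Bernoulli_inequality) auto
    then show "v \<eta> \<le> d * avg p q v \<eta>" using fix_v[OF ne] by simp
    have "(1 - avg p q v \<eta>) ^ d \<le> (1 - avg p q v \<eta>) ^ 1"
      using a d by (intro power_decreasing) auto
    then show "avg p q v \<eta> \<le> v \<eta>" using fix_v[OF ne] by simp
  qed
qed

end

subsection \<open>Comparison of consecutive lengths\<close>

text \<open>A converse of the union bound for small \<open>y\<close>, at the cost of a factor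
  \<open>t\<close>. Since \<open>(1 - y) ^ d * (1 + y) ^ d \<le> 1\<close>, Bernoulli's inequality
  gives \<open>(1 - y) ^ d \<le> 1 / (1 + d * y)\<close>.\<close>

lemma one_minus_power_ge:
  fixes y t :: real
  assumes "0 \<le> y" "y \<le> 1" "d * y \<le> t - 1" "t > 1"
  shows "d * y / t \<le> 1 - (1 - y) ^ d"
proof -
  have "(1 - y) ^ d * (1 + d * y) \<le> (1 - y) ^ d * (1 + y) ^ d"
    using assms Bernoulli_inequality[of y d] by (intro mult_left_mono) auto
  also have "\<dots> = (1 - y\<^sup>2) ^ d" 
    by (simp add: power_mult_distrib[symmetric] algebra_simps power2_eq_square)
  also have "\<dots> \<le> 1" using assms by (intro power_le_one) (auto simp: power_le_one)
  finally have "(1 - y) ^ d \<le> 1 / (1 + d * y)"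
    using assms by (simp add: field_simps add_pos_nonneg)
  moreover have "d * y / t \<le> d * y / (1 + d * y)"
    using assms by (intro divide_left_mono) (auto intro!: mult_pos_pos add_pos_nonneg)
  moreover have "d * y / (1 + d * y) = 1 - 1 / (1 + d * y)"
    using assms by (simp add: field_simps add_nonneg_eq_0_iff)
  ultimately show ?thesis by linarith
qed

text \<open>As a function of \<open>q\<close> the probability is affine with nonnegative
  coefficients, so it shrinks by no larger a factor than \<open>q\<close> does. The second bound
  serves the complementary weight.\<close>

lemma wet_prob_decrease_q:
  assumes "0 \<le> p" "p \<le> 1" "0 \<le> q'" "q' \<le> q" "q \<le> s * q'" "s \<ge> 1"
  shows "wet_prob p q \<eta> \<le> s * wet_prob p q' \<eta>" "wet_prob p q' \<eta> \<le> wet_prob p q \<eta>"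
proof -
  have "(1 - p) * q \<le> (1 - p) * (s * q')" "1 * p \<le> s * p"
    using assms by (intro mult_left_mono mult_right_mono; simp)+
  then show "wet_prob p q \<eta> \<le> s * wet_prob p q' \<eta>"
    using assms by (auto simp: wet_prob_def algebra_simps)
  have "(1 - p) * q' \<le> (1 - p) * q" using assms by (intro mult_left_mono) auto
  then show "wet_prob p q' \<eta> \<le> wet_prob p q \<eta>"
    using assms by (auto simp: wet_prob_def algebra_simps)
qed

text \<open>All losses of one level are charged here: \<open>t\<^sup>2\<close> for replacing
  \<open>q\<close> by \<open>q'\<close>, and \<open>t\<close> for linearising the branching. The
  comparison can then work with averages at \<open>q\<close>.\<close>

lemma surv_Suc_ge:
  assumes pq: "0 \<le> p" "p \<le> 1" "0 \<le> q'" "q' \<le> q" "q \<le> 1" "q \<le> t\<^sup>2 * q'" "t > 1"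
    and y: "0 \<le> y" "d * y \<le> t - 1" "y \<le> avg p q (surv d p q' n) \<xi>"
  shows "d * y / t ^ 3 \<le> surv d p q' (Suc n) \<xi>"
proof -
  let ?S = "surv d p q' n"
  have t2: "t\<^sup>2 \<ge> 1" using pq by simp
  note S = surv_nonneg[of p q' d n]
  have "avg p q ?S \<xi> \<le> t\<^sup>2 * wet_prob p q' \<xi> * ?S (True # butlast \<xi>)
      + t\<^sup>2 * (1 - wet_prob p q' \<xi>) * ?S (False # butlast \<xi>)"
    unfolding avg_def
  proof (intro add_mono mult_right_mono)
    show "wet_prob p q \<xi> \<le> t\<^sup>2 * wet_prob p q' \<xi>"
      using wet_prob_decrease_q pq t2 by simp
    have "1 * (1 - wet_prob p q' \<xi>) \<le> t\<^sup>2 * (1 - wet_prob p q' \<xi>)"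
      using t2 wet_prob_bounds[of p q' \<xi>] pq by (intro mult_right_mono) auto
    then show "1 - wet_prob p q \<xi> \<le> t\<^sup>2 * (1 - wet_prob p q' \<xi>)"
      using wet_prob_decrease_q(2)[of p q' q "t\<^sup>2" \<xi>] pq t2 by simp
  qed (use S pq in auto)
  then have y2: "y / t\<^sup>2 \<le> avg p q' ?S \<xi>"
    using y pq by (simp add: avg_def field_simps)
  have a: "avg p q' ?S \<xi> \<le> 1" using avg_surv_bounds pq by simp
  have "y / t\<^sup>2 \<le> y / 1" using t2 y by (intro divide_left_mono) auto
  then have "d * (y / t\<^sup>2) \<le> d * y" by (intro mult_left_mono) auto
  with y have "d * (y / t\<^sup>2) \<le> t - 1" by linarith
  then have "d * (y / t\<^sup>2) / t \<le> 1 - (1 - y / t\<^sup>2) ^ d"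
    using y y2 a pq order_trans[OF y2 a] by (intro one_minus_power_ge) simp_all
  also have "\<dots> \<le> surv d p q' (Suc n) \<xi>"
    using y2 a by (auto intro!: power_mono)
  finally show ?thesis using pq by (simp add: power3_eq_cube power2_eq_square mult.assoc)
qed

text \<open>Position \<open>j\<close> of the inserted \<open>False\<close> carries weight \<open>\<rho> ^ j\<close>; as each
  step of the shorter process moves it one place further, this yields a gain \<open>\<rho>\<close> per step. At
  position \<open>k\<close> it is about to be overwritten. If the newest entry is \<open>False\<close>, it can be put
  back in front for free, whence the factor \<open>d\<close> in the second claim. Otherwise the next bit
  is filled by the short edge alone; if that edge is closed and the last entry of \<open>\<eta>\<close>
  is \<open>True\<close>, the long edge gets its chance one level later, which is the third claim.\<close>

lemma surv_Suc_length_ge: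
  fixes t \<rho> \<epsilon> c p q q' :: real and v :: "bool list \<Rightarrow> real" and d k :: nat
  assumes \<rho>_def: "\<rho> = t ^ 3"
    and pq: "0 \<le> p" "p \<le> 1" "0 \<le> q'" "q' \<le> q" "q \<le> 1" "q \<le> t\<^sup>2 * q'" "t > 1" and "k \<ge> 1"
    and v0: "\<And>\<eta>. 0 \<le> v \<eta>" and v1: "\<And>\<eta>. v \<eta> \<le> 1"
    and v_False: "\<And>\<eta>. True \<notin> set \<eta> \<Longrightarrow> \<eta> \<noteq> [] \<Longrightarrow> v \<eta> = 0"
    and v_sub: "\<And>\<eta>. \<eta> \<noteq> [] \<Longrightarrow> v \<eta> \<le> d * avg p q v \<eta>"
    and v_mono: "\<And>\<eta> \<zeta>. \<eta> \<preceq> \<zeta> \<Longrightarrow> \<eta> \<noteq> [] \<Longrightarrow> v \<eta> \<le> v \<zeta>"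
    and c: "\<And>\<eta>. length \<eta> = k \<Longrightarrow> hd \<eta> \<Longrightarrow> \<not> last \<eta> \<Longrightarrow> c * v \<eta> \<le> d * v (False # butlast \<eta>)"
    and cq: "c \<le> q"
    and \<rho>: "\<rho> ^ k \<le> d" "\<rho> ^ Suc k \<le> \<rho> ^ k + (1 - p) * (d - \<rho> ^ k) * c"
    and \<epsilon>: "0 < \<epsilon>" "d * (\<epsilon> * d) \<le> t - 1" "\<epsilon> * d \<le> 1"
    and len: "length \<eta> = k"
  shows "(\<forall>j\<in>{1..k}. \<epsilon> * \<rho> ^ j * v \<eta> \<le> surv d p q' n (take j \<eta> @ False # drop j \<eta>))
    \<and> (\<not> hd \<eta> \<longrightarrow> \<epsilon> * d * v \<eta> \<le> surv d p q' n (\<eta> @ [False]))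
    \<and> (last \<eta> \<longrightarrow> \<epsilon> * d * (q * v (True # butlast \<eta>) + (1 - q) * v (False # butlast \<eta>))
          \<le> surv d p q' n (False # \<eta>))"
  using len
proof (induction n arbitrary: \<eta>)
  \<comment> \<open>Every weighted value is at most \<open>\<epsilon> * d \<le> 1\<close>, and
    survival at generation 0 equals 1 unless all entries are False, where \<open>v\<close>
    vanishes.\<close>
  case 0
  have "\<rho> > 1" using pq by (simp add: \<rho>_def)
  have ne: "\<eta> \<noteq> []" using 0 \<open>k \<ge> 1\<close> by auto
  have m: "\<epsilon> * x * y \<le> 1" if "0 \<le> x" "x \<le> d" "0 \<le> y" "y \<le> 1" for x y :: real
  proof -
    have "\<epsilon> * x * y \<le> \<epsilon> * d * 1" using that \<epsilon> by (intro mult_mono) auto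
    then show ?thesis using \<epsilon> by linarith
  qed
  have "\<rho> ^ j \<le> d" if "j \<in> {1..k}" for j
    using order_trans[OF power_increasing[of j k \<rho>] \<rho>(1)] that \<open>\<rho> > 1\<close> by auto
  moreover have "0 \<le> q * v (True # butlast \<eta>) + (1 - q) * v (False # butlast \<eta>)"
    "q * v (True # butlast \<eta>) + (1 - q) * v (False # butlast \<eta>) \<le> 1"
    using pq v0 v1 by (auto intro!: add_nonneg_nonneg mult_nonneg_nonneg convex_bound_le)
  moreover have "True \<in> set \<eta>" if "v \<eta> \<noteq> 0" using v_False that ne by blast
  moreover have "True \<in> set \<eta>" if "last \<eta>" using that ne last_in_set[of \<eta>] by auto
  moreover have "set \<eta> = set (take j \<eta>) \<union> set (drop j \<eta>)" for j
    by (metis append_take_drop_id set_append)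
  ultimately show ?case
    using m v0 v1 ne \<open>\<rho> > 1\<close> by (cases "v \<eta> = 0") auto
next
  case (Suc n)
  let ?S = "surv d p q' n"
  have rho1: "\<rho> > 1" using pq by (simp add: \<rho>_def)
  have ne: "\<eta> \<noteq> []" using Suc.prems \<open>k \<ge> 1\<close> by auto
  have q: "0 \<le> q" "q' \<le> 1" using pq by auto
  define \<theta> where "\<theta> b = b # butlast \<eta>" for b
  have len\<theta>: "length (\<theta> b) = k" for b using Suc.prems \<open>k \<ge> 1\<close> by (simp add: \<theta>_def)
  note IH1 = Suc.IH[OF len\<theta>, THEN conjunct1, rule_format]
  note IH2 = Suc.IH[OF len\<theta>, THEN conjunct2, THEN conjunct1, rule_format]
  note IH1' = Suc.IH[OF Suc.prems, THEN conjunct1, rule_format]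
  note IH3' = Suc.IH[OF Suc.prems, THEN conjunct2, THEN conjunct2, rule_format]
  \<comment> \<open>The bound \<open>y \<le> \<epsilon> * d\<close> keeps \<open>d * y\<close> below
    \<open>t - 1\<close>, the range in which a level costs only the factor
    \<open>\<rho>\<close>.\<close>
  have step: "w \<le> surv d p q' (Suc n) \<xi>"
    if "0 \<le> y" "y \<le> \<epsilon> * d" "y \<le> avg p q ?S \<xi>" "\<rho> * w \<le> d * y" for w y :: real and \<xi>
  proof -
    have "d * y \<le> d * (\<epsilon> * d)" using that by (intro mult_left_mono) auto
    then have "d * y / \<rho> \<le> surv d p q' (Suc n) \<xi>"
      unfolding \<rho>_def using that \<epsilon> pq by (intro surv_Suc_ge[where q = q]) auto
    moreover have "w \<le> d * y / \<rho>" using that rho1 by (simp add: field_simps)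
    ultimately show ?thesis by linarith
  qed
  have avg_v: "0 \<le> avg p q v \<eta>" "avg p q v \<eta> \<le> 1"
    using avg_nonneg avg_le v0 v1 pq q by auto
  have avg_v_eq: "avg p q v \<eta> = wet_prob p q \<eta> * v (\<theta> True) + (1 - wet_prob p q \<eta>) * v (\<theta> False)"
    by (simp add: avg_def \<theta>_def)
  define m where "m = q * v (\<theta> True) + (1 - q) * v (\<theta> False)"
  have m: "0 \<le> m" "m \<le> 1"
    using q pq v0 v1 by (auto simp: m_def intro!: add_nonneg_nonneg mult_nonneg_nonneg convex_bound_le)
  have rhok: "\<rho> ^ j \<le> d" if "j \<le> k" for j
    using order_trans[OF power_increasing[OF that, of \<rho>] \<rho>(1)] rho1 by auto
  \<comment> \<open>With the inserted False strictly inside, the first and last entries are those of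
    \<open>\<eta>\<close>, so both processes use the same probabilities and the False moves on by
    one place.\<close>
  have I1_lt: "\<epsilon> * \<rho> ^ j * v \<eta> \<le> surv d p q' (Suc n) (take j \<eta> @ False # drop j \<eta>)"
    if j: "1 \<le> j" "j < k" for j
  proof -
    let ?\<xi> = "take j \<eta> @ False # drop j \<eta>"
    have wet: "wet_prob p q ?\<xi> = wet_prob p q \<eta>"
      using j Suc.prems ne by (simp add: wet_prob_def hd_append)
    have bl: "b # butlast ?\<xi> = take (Suc j) (\<theta> b) @ False # drop (Suc j) (\<theta> b)" for b
      using j Suc.prems by (simp add: \<theta>_def butlast_append take_butlast drop_butlast)
    have "\<epsilon> * \<rho> ^ Suc j * avg p q v \<eta> = avg p q (\<lambda>\<zeta>. \<epsilon> * \<rho> ^ Suc j * v \<zeta>) \<eta>"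
      by (simp add: avg_def algebra_simps)
    also have "\<dots> \<le> avg p q ?S ?\<xi>"
      unfolding avg_def bl wet \<theta>_def[symmetric]
      using IH1[of "Suc j"] j wet_prob_bounds[of p q] pq q
      by (intro add_mono mult_left_mono) auto
    finally have le: "\<epsilon> * \<rho> ^ Suc j * avg p q v \<eta> \<le> avg p q ?S ?\<xi>" .
    show ?thesis
    proof (rule step[OF _ _ le])
      show "0 \<le> \<epsilon> * \<rho> ^ Suc j * avg p q v \<eta>" using \<epsilon> rho1 avg_v by simp
      have "\<epsilon> * \<rho> ^ Suc j * avg p q v \<eta> \<le> \<epsilon> * d * 1"
        using \<epsilon> rhok[of "Suc j"] rho1 avg_v j by (intro mult_mono) auto
      then show "\<epsilon> * \<rho> ^ Suc j * avg p q v \<eta> \<le> \<epsilon> * d" by simp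
      have "\<epsilon> * \<rho> ^ Suc j * v \<eta> \<le> \<epsilon> * \<rho> ^ Suc j * (d * avg p q v \<eta>)"
        using \<epsilon> rho1 v_sub[OF ne] by (intro mult_left_mono) auto
      then show "\<rho> * (\<epsilon> * \<rho> ^ j * v \<eta>) \<le> d * (\<epsilon> * \<rho> ^ Suc j * avg p q v \<eta>)"
        by (simp add: algebra_simps)
    qed
  qed
  have I2: "\<epsilon> * d * v \<eta> \<le> surv d p q' (Suc n) (\<eta> @ [False])" if "\<not> hd \<eta>"
  proof -
    \<comment> \<open>Next to a False head, insertion in front and insertion at position 1 give the
      same list.\<close>
    have tl: "take 1 \<eta> @ False # drop 1 \<eta> = False # \<eta>" using ne that by (cases \<eta>) auto
    show ?thesis
    proof (rule step[of "\<epsilon> * \<rho> ^ 1 * v \<eta>"])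
      show "0 \<le> \<epsilon> * \<rho> ^ 1 * v \<eta>" using \<epsilon> rho1 v0 by simp
      have "\<epsilon> * \<rho> ^ 1 * v \<eta> \<le> \<epsilon> * d * 1"
        using \<epsilon> rhok[of 1] rho1 v0 v1 \<open>k \<ge> 1\<close> by (intro mult_mono) auto
      then show "\<epsilon> * \<rho> ^ 1 * v \<eta> \<le> \<epsilon> * d" by simp
      have "avg p q ?S (\<eta> @ [False]) = ?S (False # \<eta>)"
        using that ne by (simp add: avg_def wet_prob_def)
      then show "\<epsilon> * \<rho> ^ 1 * v \<eta> \<le> avg p q ?S (\<eta> @ [False])"
        using IH1'[of 1] \<open>k \<ge> 1\<close> unfolding tl by simp
    qed (simp add: algebra_simps)
  qed
  \<comment> \<open>The False in front disables the short edge while \<open>last \<eta>\<close>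
    still feeds the long edge; either outcome leaves the inserted False at position 1 of
    \<open>\<theta> b\<close>.\<close>
  have I3: "\<epsilon> * d * m \<le> surv d p q' (Suc n) (False # \<eta>)" if "last \<eta>"
  proof (rule step[of "\<epsilon> * \<rho> * m"])
    show "0 \<le> \<epsilon> * \<rho> * m" using \<epsilon> rho1 m by simp
    have "\<epsilon> * \<rho> * m \<le> \<epsilon> * d * 1"
      using \<epsilon> rhok[of 1] rho1 m \<open>k \<ge> 1\<close> by (intro mult_mono) auto
    then show "\<epsilon> * \<rho> * m \<le> \<epsilon> * d" by simp
    have bl: "b # butlast (False # \<eta>) = take 1 (\<theta> b) @ False # drop 1 (\<theta> b)" for b
      using ne by (simp add: \<theta>_def)
    have "wet_prob p q (False # \<eta>) = q" using that ne by (simp add: wet_prob_def)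
    then have "q * (\<epsilon> * \<rho> ^ 1 * v (\<theta> True)) + (1 - q) * (\<epsilon> * \<rho> ^ 1 * v (\<theta> False)) \<le> avg p q ?S (False # \<eta>)"
      unfolding avg_def bl using IH1[of 1] \<open>k \<ge> 1\<close> pq q by (auto intro!: add_mono mult_left_mono)
    then show "\<epsilon> * \<rho> * m \<le> avg p q ?S (False # \<eta>)"
      by (simp add: m_def algebra_simps)
  qed (simp add: algebra_simps)
  have I1_k: "\<epsilon> * \<rho> ^ k * v \<eta> \<le> surv d p q' (Suc n) (\<eta> @ [False])"
  proof (cases "hd \<eta>")
    case False
    have "\<epsilon> * \<rho> ^ k * v \<eta> \<le> \<epsilon> * d * v \<eta>"
      using \<epsilon> \<rho> v0 by (intro mult_right_mono mult_left_mono) auto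
    then show ?thesis using I2[OF False] by linarith
  next
    case hd: True
    \<comment> \<open>\<open>z\<close> is the mean of \<open>v\<close> in the shorter process given
      that the short edge is closed. The longer process obtains it with weight \<open>d\<close>
      instead of \<open>\<rho> ^ k\<close>.\<close>
    define z where "z = (if last \<eta> then m else v (\<theta> False))"
    have z: "0 \<le> z" "z \<le> 1" using m v0 v1 by (auto simp: z_def)
    have avg_z: "avg p q v \<eta> = p * v (\<theta> True) + (1 - p) * z"
      unfolding avg_v_eq using hd by (simp add: z_def m_def wet_prob_def algebra_simps)
    \<comment> \<open>After an open short edge the oldest entry is discarded by monotonicity, which
      puts the inserted False back at position \<open>k\<close>.\<close>
    have "?S (True # butlast \<eta> @ [False]) \<le> ?S (True # \<eta>)"
    proof -
      have "butlast \<eta> @ [False] \<preceq> butlast \<eta> @ [last \<eta>]"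
        by (intro list_all2_appendI state_le_refl) simp
      then show ?thesis using ne pq q by (intro surv_mono) auto
    qed
    moreover have "\<epsilon> * \<rho> ^ k * v (\<theta> True) \<le> ?S (True # butlast \<eta> @ [False])"
      using IH1[of k True] \<open>k \<ge> 1\<close> len\<theta>[of True] by (simp add: \<theta>_def)
    ultimately have ST: "\<epsilon> * \<rho> ^ k * v (\<theta> True) \<le> ?S (True # \<eta>)" by linarith
    have SF: "\<epsilon> * d * z \<le> ?S (False # \<eta>)"
    proof (cases "last \<eta>")
      case True
      then show ?thesis using IH3' by (simp add: z_def m_def \<theta>_def)
    next
      case False
      \<comment> \<open>A False at the old end can itself serve as the inserted one; the new head is
        False, so the second claim applies.\<close>
      then have "False # \<eta> = \<theta> False @ [False]"
        using append_butlast_last_id[OF ne] by (simp add: \<theta>_def)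
      then show ?thesis using IH2[of False] False by (simp add: z_def) (simp add: \<theta>_def)
    qed
    have cz: "c * v \<eta> \<le> d * z"
    proof (cases "last \<eta>")
      case True
      have "avg p q v \<eta> \<le> v (\<theta> True)"
      proof (rule avg_le)
        fix b show "v (b # butlast \<eta>) \<le> v (\<theta> True)"
          unfolding \<theta>_def by (rule v_mono) (auto simp: state_le_refl)
      qed (use pq q in auto)
      then have "d * avg p q v \<eta> \<le> d * v (\<theta> True)" by (intro mult_left_mono) auto
      then have "v \<eta> \<le> d * v (\<theta> True)" using v_sub[OF ne] by linarith
      then have "q * v \<eta> \<le> q * (d * v (\<theta> True))" using q by (intro mult_left_mono) auto
      moreover have "c * v \<eta> \<le> q * v \<eta>" using cq v0 by (intro mult_right_mono) auto
      moreover have "0 \<le> d * ((1 - q) * v (\<theta> False))" using pq v0 by simp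
      ultimately show ?thesis using True by (simp add: z_def m_def algebra_simps)
    next
      case False
      then show ?thesis using c[OF Suc.prems hd] by (simp add: z_def \<theta>_def)
    qed
    define y where "y = \<epsilon> * (p * \<rho> ^ k * v (\<theta> True) + (1 - p) * d * z)"
    show ?thesis
    proof (rule step[of y])
      show "0 \<le> y" using \<epsilon> pq rho1 v0 z by (auto simp: y_def intro!: mult_nonneg_nonneg add_nonneg_nonneg)
      have "p * (\<rho> ^ k * v (\<theta> True)) + (1 - p) * (d * z) \<le> d"
      proof (rule convex_bound_le)
        have "\<rho> ^ k * v (\<theta> True) \<le> d * (1::real)" using \<rho> v0 v1 rho1 by (intro mult_mono) auto
        then show "\<rho> ^ k * v (\<theta> True) \<le> d" by simp
        have "d * z \<le> d * (1::real)" using z by (intro mult_left_mono) auto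
        then show "d * z \<le> d" by simp
      qed (use pq in auto)
      then show "y \<le> \<epsilon> * d" using \<epsilon> by (simp add: y_def mult.assoc)
      have "y = p * (\<epsilon> * \<rho> ^ k * v (\<theta> True)) + (1 - p) * (\<epsilon> * d * z)"
        by (simp add: y_def algebra_simps)
      also have "\<dots> \<le> p * ?S (True # \<eta>) + (1 - p) * ?S (False # \<eta>)"
        using ST SF pq by (intro add_mono mult_left_mono) auto
      also have "\<dots> = avg p q ?S (\<eta> @ [False])"
        using hd ne by (simp add: avg_def wet_prob_def)
      finally show "y \<le> avg p q ?S (\<eta> @ [False])" .
      \<comment> \<open>The surplus \<open>(1 - p) * (d - \<rho> ^ k) * z\<close> over the plain
        weight \<open>\<rho> ^ k\<close> is measured against \<open>v \<eta>\<close> through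
        \<open>cz\<close>; the choice of \<open>\<rho>\<close> makes it cover one more factor
        \<open>\<rho>\<close>.\<close>
      have "\<rho> ^ Suc k * v \<eta> \<le> (\<rho> ^ k + (1 - p) * (d - \<rho> ^ k) * c) * v \<eta>"
        using \<rho> v0 by (intro mult_right_mono) auto
      also have "\<dots> = \<rho> ^ k * v \<eta> + (1 - p) * (d - \<rho> ^ k) * (c * v \<eta>)"
        by (simp add: algebra_simps)
      also have "\<dots> \<le> \<rho> ^ k * (d * avg p q v \<eta>) + (1 - p) * (d - \<rho> ^ k) * (d * z)"
        using v_sub[OF ne] cz pq \<rho> rho1 by (intro add_mono mult_left_mono) auto
      also have "\<dots> = d * (p * \<rho> ^ k * v (\<theta> True) + (1 - p) * d * z)"
        unfolding avg_z by (simp add: algebra_simps)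
      finally have "\<epsilon> * (\<rho> ^ Suc k * v \<eta>) \<le> \<epsilon> * (d * (p * \<rho> ^ k * v (\<theta> True) + (1 - p) * d * z))"
        using \<epsilon> by (intro mult_left_mono) auto
      then show "\<rho> * (\<epsilon> * \<rho> ^ k * v \<eta>) \<le> d * y" by (simp add: y_def algebra_simps)
    qed
  qed
  show ?case
  proof (intro conjI ballI impI)
    fix j assume "j \<in> {1..k}"
    then show "\<epsilon> * \<rho> ^ j * v \<eta> \<le> surv d p q' (Suc n) (take j \<eta> @ False # drop j \<eta>)"
      using I1_lt[of j] I1_k Suc.prems by (cases "j = k") auto
  qed (use I2 I3 in \<open>auto simp: m_def \<theta>_def\<close>)
qed

text \<open>After the failed update the lost ground can be regained along one ray: updates by False
  until the old head of \<open>\<eta>\<close> is last, then an open long edge, then \<open>k\<close>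
  open short edges. This ends in the all-True state, which dominates \<open>\<eta>\<close>. For
  \<open>p = 0\<close> the update by False is certain.\<close>

lemma loss_bound:
  fixes v :: "bool list \<Rightarrow> real" and p q q\<^sub>0 :: real and d k :: nat
  assumes pq: "0 \<le> p" "p \<le> 1" "0 \<le> q\<^sub>0" "q\<^sub>0 \<le> q" "q \<le> 1" and d: "d \<ge> 1" and k: "k \<ge> 1"
    and v0: "\<And>\<eta>. 0 \<le> v \<eta>"
    and v_mono: "\<And>\<eta> \<zeta>. \<eta> \<preceq> \<zeta> \<Longrightarrow> \<eta> \<noteq> [] \<Longrightarrow> v \<eta> \<le> v \<zeta>"
    and v_sub: "\<And>\<eta>. \<eta> \<noteq> [] \<Longrightarrow> v \<eta> \<le> d * avg p q v \<eta>"
    and v_super: "\<And>\<eta>. \<eta> \<noteq> [] \<Longrightarrow> avg p q v \<eta> \<le> v \<eta>"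
    and len: "length \<eta> = k" and hd: "hd \<eta>" and last: "\<not> last \<eta>"
  shows "q\<^sub>0 * (if p = 0 then 1 else p ^ k) * v \<eta> \<le> d * v (False # butlast \<eta>)"
proof (cases "p = 0")
  case True
  have ne: "\<eta> \<noteq> []" using len k by auto
  have "v \<eta> \<le> d * v (False # butlast \<eta>)"
    using v_sub[OF ne] last True by (simp add: avg_def wet_prob_def)
  moreover have "q\<^sub>0 * v \<eta> \<le> 1 * v \<eta>" using pq v0 by (intro mult_right_mono) auto
  ultimately show ?thesis using True by simp
next
  case p: False
  have q: "0 \<le> q" using pq by simp
  have split: "x * v (True # butlast \<zeta>) + (1 - x) * v (False # butlast \<zeta>) \<le> v \<zeta>"
    if "\<zeta> \<noteq> []" "x = wet_prob p q \<zeta>" for x \<zeta>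
    using v_super[OF that(1)] that(2) by (simp add: avg_def)
  have wet: "x * v (True # butlast \<zeta>) \<le> v \<zeta>" if "\<zeta> \<noteq> []" "0 \<le> x" "x \<le> wet_prob p q \<zeta>" for x \<zeta>
  proof -
    have "x * v (True # butlast \<zeta>) \<le> wet_prob p q \<zeta> * v (True # butlast \<zeta>)"
      using that v0 by (intro mult_right_mono) auto
    moreover have "0 \<le> (1 - wet_prob p q \<zeta>) * v (False # butlast \<zeta>)"
      using wet_prob_bounds[of p q \<zeta>] pq q v0 by simp
    ultimately show ?thesis using split[OF that(1) refl] by linarith
  qed
  \<comment> \<open>An update by False is the worse of the two, so waiting costs no factor of
    probability.\<close>
  have shift: "v (False # butlast \<zeta>) \<le> v \<zeta>" if "\<zeta> \<noteq> []" for \<zeta>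
  proof -
    have "v (False # butlast \<zeta>) \<le> v (True # butlast \<zeta>)"
      by (intro v_mono) (auto simp: state_le_refl)
    then have "v (False # butlast \<zeta>) \<le> avg p q v \<zeta>"
      using pq q by (intro avg_ge) (auto split: bool.split, metis (full_types) order_refl)
    then show ?thesis using v_super[OF that] by linarith
  qed
  have Falses: "v (replicate m False @ take (length \<zeta> - m) \<zeta>) \<le> v \<zeta>" if "\<zeta> \<noteq> []" "m \<le> length \<zeta>" for m \<zeta>
    using that(2)
  proof (induction m)
    case (Suc m)
    let ?x = "replicate m False @ take (length \<zeta> - m) \<zeta>"
    have "butlast ?x = replicate m False @ take (length \<zeta> - Suc m) \<zeta>"
      using Suc.prems that by (auto simp: butlast_append butlast_take)
    moreover have "?x \<noteq> []" using that Suc.prems by auto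
    ultimately show ?case using shift[of ?x] Suc by simp
  qed simp
  have Trues: "p ^ m * v (replicate m True @ take (length \<zeta> - m) \<zeta>) \<le> v \<zeta>"
    if "\<zeta> \<noteq> []" "hd \<zeta>" "m \<le> length \<zeta>" for m \<zeta>
    using that(3)
  proof (induction m)
    case (Suc m)
    let ?x = "replicate m True @ take (length \<zeta> - m) \<zeta>"
    have bl: "butlast ?x = replicate m True @ take (length \<zeta> - Suc m) \<zeta>"
      using Suc.prems that by (auto simp: butlast_append butlast_take)
    have ne: "?x \<noteq> []" using that Suc.prems by auto
    have "hd ?x" using that Suc.prems by (cases m) (auto simp: hd_append)
    then have "p \<le> wet_prob p q ?x"
      using pq mult_left_mono[of "1 - q" 1 "1 - p"] q by (simp add: wet_prob_def)
    from wet[OF ne _ this] pq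
    have "p * v (True # butlast ?x) \<le> v ?x" by simp
    then have "p ^ m * (p * v (True # butlast ?x)) \<le> p ^ m * v ?x"
      using pq by (intro mult_left_mono) auto
    then show ?case using Suc bl by (simp add: mult.assoc mult.left_commute)
  qed simp
  have k2: "k \<ge> 2"
  proof (rule ccontr)
    assume "\<not> k \<ge> 2"
    then have "length \<eta> = 1" using len k by simp
    then show False using hd last by (cases \<eta>) auto
  qed
  define \<zeta> where "\<zeta> = False # butlast \<eta>"
  have \<zeta>: "length \<zeta> = k" "\<zeta> \<noteq> []" using len k2 by (auto simp: \<zeta>_def)
  have "\<eta> \<noteq> []" "butlast \<eta> \<noteq> []" using len k2 by (auto simp flip: length_0_conv)
  then have t2: "take 2 \<zeta> = [False, True]" using hd by (cases \<eta>) (auto simp: \<zeta>_def numeral_2_eq_2)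
  \<comment> \<open>This is \<open>\<zeta>\<close> after \<open>k - 2\<close> updates by False at
    worst: the old head of \<open>\<eta>\<close> is now the source of the next long edge.\<close>
  define \<xi> where "\<xi> = replicate (k - 2) False @ [False, True]"
  have "v \<xi> \<le> v \<zeta>" using Falses[of \<zeta> "k - 2"] \<zeta> k2 t2 by (simp add: \<xi>_def)
  moreover have "q * v (True # butlast \<xi>) \<le> v \<xi>"
  proof (rule wet)
    have "(1 - (if hd \<xi> then p else 0)) * (1 - q) \<le> 1 * (1 - q)"
      using pq by (intro mult_right_mono) auto
    then show "q \<le> wet_prob p q \<xi>" by (simp add: wet_prob_def \<xi>_def)
  qed (use q in \<open>auto simp: \<xi>_def\<close>)
  moreover have "p ^ k * v (replicate k True) \<le> v (True # butlast \<xi>)"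
    using Trues[of "True # butlast \<xi>" k] k2 by (simp add: \<xi>_def)
  moreover have "v \<eta> \<le> v (replicate k True)"
    using len \<open>\<eta> \<noteq> []\<close> by (intro v_mono) (auto simp: list_all2_conv_all_nth)
  ultimately have "q * (p ^ k * v \<eta>) \<le> v \<zeta>"
    using pq q by (meson mult_left_mono order_trans zero_le_power)
  moreover have "q\<^sub>0 * (p ^ k * v \<eta>) \<le> q * (p ^ k * v \<eta>)"
    using pq v0 by (intro mult_right_mono) auto
  moreover have "1 * v \<zeta> \<le> d * v \<zeta>" using d v0 by (intro mult_right_mono) auto
  ultimately show ?thesis using p by (simp add: \<zeta>_def mult.assoc)
qed

text \<open>At \<open>t = 1\<close> the last two inequalities read \<open>1 \<le> d\<close> and
  \<open>1 \<le> 1 + (1 - p) * (d - 1) * c\<close>. Both are strict there, so by continuity they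
  persist slightly to the right.\<close>

lemma ex_rate:
  fixes p c :: real
  assumes "p < 1" "c > 0" "d \<ge> (2::nat)"
  obtains t :: real where "t > 1" "(t ^ 3) ^ k \<le> d"
    "(t ^ 3) ^ Suc k \<le> (t ^ 3) ^ k + (1 - p) * (d - (t ^ 3) ^ k) * c"
proof -
  have "((\<lambda>t::real. (t ^ 3) ^ k) \<longlongrightarrow> (1 ^ 3) ^ k) (at_right 1)"
    by (intro tendsto_intros)
  then have "\<forall>\<^sub>F t in at_right 1. (t ^ 3) ^ k < real d"
    using assms by (intro order_tendstoD(2)) auto
  moreover have "((\<lambda>t::real. (t ^ 3) ^ k + (1 - p) * (d - (t ^ 3) ^ k) * c - (t ^ 3) ^ Suc k)
      \<longlongrightarrow> (1 ^ 3) ^ k + (1 - p) * (d - ((1::real) ^ 3) ^ k) * c - (1 ^ 3) ^ Suc k) (at_right 1)"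
    by (intro tendsto_intros)
  then have "\<forall>\<^sub>F t::real in at_right 1. 0 < (t ^ 3) ^ k + (1 - p) * (d - (t ^ 3) ^ k) * c - (t ^ 3) ^ Suc k"
    by (rule order_tendstoD(1)) (use assms in simp)
  moreover have "\<forall>\<^sub>F t::real in at_right 1. 1 < t" by (rule eventually_at_right_less)
  ultimately have "\<forall>\<^sub>F t::real in at_right 1. 1 < t \<and> (t ^ 3) ^ k < real d \<and>
      0 < (t ^ 3) ^ k + (1 - p) * (d - (t ^ 3) ^ k) * c - (t ^ 3) ^ Suc k"
    by eventually_elim simp
  then obtain t :: real where "1 < t \<and> (t ^ 3) ^ k < real d \<and>
      0 < (t ^ 3) ^ k + (1 - p) * (d - (t ^ 3) ^ k) * c - (t ^ 3) ^ Suc k"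
    using eventually_happens' trivial_limit_at_right_real by blast
  then show ?thesis by (intro that) auto
qed

abbreviation init_state :: "nat \<Rightarrow> bool list" where
  "init_state k \<equiv> True # replicate (k - 1) False"

text \<open>\<open>r\<close> comes before \<open>q\<close> and \<open>a\<close>, so \<open>q\<close>
  may afterwards be chosen within a factor \<open>r\<close> of an infimum.\<close>

lemma surv_longer:
  fixes p q\<^sub>0 :: real
  assumes d: "d \<ge> 2" and k: "k \<ge> 1" and p: "0 \<le> p" "p < 1" and q0: "0 < q\<^sub>0"
  obtains r where "r > 1"
    and "\<And>q a. q\<^sub>0 \<le> q \<Longrightarrow> q < r * q\<^sub>0 \<Longrightarrow> q \<le> 1 \<Longrightarrow> 0 < a \<Longrightarrow>
      (\<And>n. a \<le> surv d p q n (init_state k)) \<Longrightarrow>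
      \<exists>b>0. \<forall>n. b \<le> surv d p (q\<^sub>0 / r) n (init_state (Suc k))"
proof -
  \<comment> \<open>The constant of \<open>loss_bound\<close>, which serves every
    \<open>q \<ge> q\<^sub>0\<close>. The power \<open>p ^ k\<close> would vanish for
    \<open>p = 0\<close>.\<close>
  define c where "c = q\<^sub>0 * (if p = 0 then 1 else p ^ k)"
  have "c > 0" using p q0 by (auto simp: c_def)
  have "(if p = 0 then 1 else p ^ k) \<le> 1" using p by (auto intro: power_le_one)
  then have cq: "c \<le> q\<^sub>0" using q0 mult_left_mono[of _ 1 q\<^sub>0] by (simp add: c_def)
  obtain t :: real where t: "t > 1" "(t ^ 3) ^ k \<le> d"
    "(t ^ 3) ^ Suc k \<le> (t ^ 3) ^ k + (1 - p) * (d - (t ^ 3) ^ k) * c"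
    using ex_rate[of p c d k] d p \<open>c > 0\<close> by auto
  show ?thesis
  proof (rule that[OF t(1)])
    fix q a assume q: "q\<^sub>0 \<le> q" "q < t * q\<^sub>0" "q \<le> 1" and a: "0 < a"
      and surv: "\<And>n. a \<le> surv d p q n (init_state k)"
    have pq: "0 \<le> p" "p \<le> 1" "0 \<le> q" "q \<le> 1" using p q q0 by auto
    have d1: "1 \<le> d" using d by simp
    show "\<exists>b>0. \<forall>n. b \<le> surv d p (q\<^sub>0 / t) n (init_state (Suc k))"
    proof (rule surv_limit[OF pq d1])
      fix v assume v: "\<And>\<eta>. \<eta> \<noteq> [] \<Longrightarrow> (\<lambda>n. surv d p q n \<eta>) \<longlonglongrightarrow> v \<eta>"
        "\<And>\<eta>. 0 \<le> v \<eta>" "\<And>\<eta>. v \<eta> \<le> 1"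
        "\<And>\<eta> \<zeta>. \<eta> \<preceq> \<zeta> \<Longrightarrow> \<eta> \<noteq> [] \<Longrightarrow> v \<eta> \<le> v \<zeta>"
        "\<And>\<eta>. True \<notin> set \<eta> \<Longrightarrow> \<eta> \<noteq> [] \<Longrightarrow> v \<eta> = 0"
        "\<And>\<eta>. \<eta> \<noteq> [] \<Longrightarrow> v \<eta> \<le> d * avg p q v \<eta>"
        "\<And>\<eta>. \<eta> \<noteq> [] \<Longrightarrow> avg p q v \<eta> \<le> v \<eta>"
      \<comment> \<open>The first bound settles generation 0, the second keeps every later level in
        the linear range.\<close>
      define \<epsilon> where "\<epsilon> = min (1 / d) ((t - 1) / (d * d))"
      have "\<epsilon> > 0" using d t by (simp add: \<epsilon>_def)
      have "\<epsilon> \<le> 1 / d" "\<epsilon> \<le> (t - 1) / (d * d)" by (auto simp: \<epsilon>_def)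
      then have \<epsilon>: "\<epsilon> * d \<le> 1" "d * (\<epsilon> * d) \<le> t - 1" using d by (auto simp: field_simps)
      have a_le: "a \<le> v (init_state k)" using LIMSEQ_le_const[OF v(1)[of "init_state k"]] surv by auto
      define b where "b = \<epsilon> * (t ^ 3) ^ 1 * v (init_state k)"
      have "b > 0" using \<open>\<epsilon> > 0\<close> t a a_le by (simp add: b_def)
      have q0t: "q\<^sub>0 / t \<le> q" using q0 t q frac_le[of q\<^sub>0 q\<^sub>0 1 t] by simp
      have "b \<le> surv d p (q\<^sub>0 / t) n (init_state (Suc k))" for n
      proof -
        \<comment> \<open>For \<open>q' = q\<^sub>0 / t\<close> the requirement
          \<open>q \<le> t\<^sup>2 * q'\<close> reads \<open>q \<le> t * q\<^sub>0\<close>.\<close>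
        have "\<epsilon> * (t ^ 3) ^ 1 * v (init_state k)
            \<le> surv d p (q\<^sub>0 / t) n (take 1 (init_state k) @ False # drop 1 (init_state k))"
          using surv_Suc_length_ge[OF refl, of p "q\<^sub>0 / t" q t k v d c \<epsilon> "init_state k" n,
              THEN conjunct1, rule_format, of 1]
            v(2-6) pq q q0 q0t t k \<epsilon> \<open>\<epsilon> > 0\<close> cq
            loss_bound[OF pq(1,2) _ q(1,3) d1 k v(2,4,6,7), folded c_def]
          by (simp add: power2_eq_square)
        moreover have "take 1 (init_state k) @ False # drop 1 (init_state k) = init_state (Suc k)"
          using k by (cases k) auto
        ultimately show ?thesis by (simp add: b_def)
      qed
      then show ?thesis using \<open>b > 0\<close> by blast
    qed
  qed
qed

subsection \<open>Independence in product spaces\<close>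

context product_prob_space
begin

lemma indep_vars_coordinates:
  assumes "I \<noteq> {}"
  shows "P.indep_vars M (\<lambda>i \<omega>. \<omega> i) I"
proof -
  have "distr (PiM I M) (PiM I M) (\<lambda>x. restrict x I) = distr (PiM I M) (PiM I M) (\<lambda>x. x)"
    by (intro distr_cong) (auto simp: space_PiM PiE_def extensional_restrict)
  also have "\<dots> = PiM I M" by simp
  also have "\<dots> = PiM I (\<lambda>i. distr (PiM I M) (M i) (\<lambda>\<omega>. \<omega> i))"
    using PiM_component by (intro PiM_cong) auto
  finally show ?thesis
    using assms by (subst P.indep_vars_iff_distr_eq_PiM') auto
qed

text \<open>Each event factors through the restriction to its own coordinates, and restrictions to
  disjoint index sets are independent.\<close>

lemma prob_all_disjoint_coordinates:
  assumes "finite A" "A \<noteq> {}" "I \<noteq> {}"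
    and K: "\<And>a. a \<in> A \<Longrightarrow> K a \<subseteq> I" "disjoint_family_on K A"
    and meas: "\<And>a. a \<in> A \<Longrightarrow> Measurable.pred (PiM I M) (Q a)"
    and dep: "\<And>a \<omega> \<omega>'. a \<in> A \<Longrightarrow> (\<And>i. i \<in> K a \<Longrightarrow> \<omega> i = \<omega>' i) \<Longrightarrow> Q a \<omega> = Q a \<omega>'"
  shows "P.prob {\<omega> \<in> space (PiM I M). \<forall>a\<in>A. Q a \<omega>} = (\<Prod>a\<in>A. P.prob {\<omega> \<in> space (PiM I M). Q a \<omega>})"
proof -
  obtain \<omega>\<^sub>0 where \<omega>0: "\<omega>\<^sub>0 \<in> space (PiM I M)" using P.not_empty by blast
  \<comment> \<open>Off \<open>K a\<close> a fixed point of the space supplies the values; by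
    \<open>dep\<close> they do not affect \<open>Q a\<close>.\<close>
  define ext where "ext a x = (\<lambda>i\<in>I. if i \<in> K a then x i else \<omega>\<^sub>0 i)" for a x
  have ext_meas: "ext a \<in> measurable (PiM (K a) M) (PiM I M)" if "a \<in> A" for a
    unfolding ext_def
  proof (intro measurable_restrict)
    fix i assume "i \<in> I"
    then have "\<omega>\<^sub>0 i \<in> space (M i)" using \<omega>0 by (auto simp: space_PiM)
    then show "(\<lambda>x. if i \<in> K a then x i else \<omega>\<^sub>0 i) \<in> measurable (PiM (K a) M) (M i)"
      by (cases "i \<in> K a") auto
  qed
  have Q_ext: "Q a (ext a (restrict \<omega> (K a))) = Q a \<omega>" if "a \<in> A" for a \<omega>
    using that K(1)[OF that] by (intro dep) (auto simp: ext_def)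
  have Q_meas: "Measurable.pred (PiM (K a) M) (\<lambda>x. Q a (ext a x))" if "a \<in> A" for a
    using measurable_compose[OF ext_meas[OF that] meas[OF that]] .
  have "P.indep_vars (\<lambda>a. PiM (K a) M) (\<lambda>a \<omega>. restrict (\<lambda>i. \<omega> i) (K a)) A"
    using K assms by (intro P.indep_vars_restrict[OF indep_vars_coordinates]) auto
  then have "P.indep_vars (\<lambda>a. count_space UNIV) (\<lambda>a \<omega>. Q a (ext a (restrict \<omega> (K a)))) A"
    by (rule P.indep_vars_compose2[where Y = "\<lambda>a x. Q a (ext a x)"]) (rule Q_meas)
  then have "P.indep_vars (\<lambda>a. count_space UNIV) Q A"
    by (subst (asm) P.indep_vars_cong) (auto simp: Q_ext)
  then have "P.prob (\<Inter>a\<in>A. Q a -` {True} \<inter> space (PiM I M))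
      = (\<Prod>a\<in>A. P.prob (Q a -` {True} \<inter> space (PiM I M)))"
    using assms by (intro P.indep_varsD) auto
  moreover have "(\<Inter>a\<in>A. Q a -` {True} \<inter> space (PiM I M)) = {\<omega> \<in> space (PiM I M). \<forall>a\<in>A. Q a \<omega>}"
    using \<open>A \<noteq> {}\<close> by auto
  moreover have "Q a -` {True} \<inter> space (PiM I M) = {\<omega> \<in> space (PiM I M). Q a \<omega>}" for a
    by auto
  ultimately show ?thesis by simp
qed

lemma prob_conj_disjoint_coordinates:
  assumes "I \<noteq> {}" "K \<subseteq> I" "L \<subseteq> I" "K \<inter> L = {}"
    and "Measurable.pred (PiM I M) Q" "Measurable.pred (PiM I M) R"
    and "\<And>\<omega> \<omega>'. (\<And>i. i \<in> K \<Longrightarrow> \<omega> i = \<omega>' i) \<Longrightarrow> Q \<omega> = Q \<omega>'"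
    and "\<And>\<omega> \<omega>'. (\<And>i. i \<in> L \<Longrightarrow> \<omega> i = \<omega>' i) \<Longrightarrow> R \<omega> = R \<omega>'"
  shows "P.prob {\<omega> \<in> space (PiM I M). Q \<omega> \<and> R \<omega>}
    = P.prob {\<omega> \<in> space (PiM I M). Q \<omega>} * P.prob {\<omega> \<in> space (PiM I M). R \<omega>}"
proof -
  have "P.prob {\<omega> \<in> space (PiM I M). \<forall>b\<in>UNIV. (if b then Q else R) \<omega>}
    = (\<Prod>b\<in>UNIV. P.prob {\<omega> \<in> space (PiM I M). (if b then Q else R) \<omega>})"
  proof (rule prob_all_disjoint_coordinates[where K = "\<lambda>b. if b then K else L"])
    show "(if b then Q else R) \<omega> = (if b then Q else R) \<omega>'"
      if "\<And>i. i \<in> (if b then K else L) \<Longrightarrow> \<omega> i = \<omega>' i" for b \<omega> \<omega>'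
      using assms(7,8)[of \<omega> \<omega>'] that by (cases b) simp_all
  qed (use assms(1-6) in \<open>auto simp: disjoint_family_on_def\<close>)
  moreover have "(\<forall>b\<in>UNIV. (if b then Q else R) \<omega>) \<longleftrightarrow> Q \<omega> \<and> R \<omega>" for \<omega>
    by (simp add: all_bool_eq)
  ultimately show ?thesis by (simp only: UNIV_bool) simp
qed

end

subsection \<open>Percolation as a branching process\<close>

primrec endpoint :: "edge \<Rightarrow> nat list" where
  "endpoint (Short u a) = u @ [a]"
| "endpoint (Long u r) = u @ r"

text \<open>A vertex of length at least \<open>k\<close> ends exactly one long edge, so long edges
  can be named, and all edges sorted, by endpoint.\<close>

definition long_into :: "nat \<Rightarrow> nat list \<Rightarrow> edge" where
  "long_into k v = Long (take (length v - k) v) (drop (length v - k) v)"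

lemma long_into_simps [simp]:
  "endpoint (long_into k v) = v" "edge_prob p q (long_into k v) = q"
  "Short u a \<noteq> long_into k v" "long_into k v \<noteq> Short u a"
  by (simp_all add: long_into_def edge_prob_def)

definition wet :: "nat \<Rightarrow> (edge \<Rightarrow> bool) \<Rightarrow> nat list \<Rightarrow> nat \<Rightarrow> bool list \<Rightarrow> bool" where
  "wet k \<omega> u a \<eta> \<longleftrightarrow> hd \<eta> \<and> \<omega> (Short u a) \<or> last \<eta> \<and> \<omega> (long_into k (u @ [a]))"

text \<open>The state \<open>\<eta>\<close> is a free parameter, not read off from
  \<open>\<omega>\<close>. This separates the past of \<open>u\<close> from the edges ending below
  it.\<close>

primrec alive :: "nat \<Rightarrow> nat \<Rightarrow> (edge \<Rightarrow> bool) \<Rightarrow> nat \<Rightarrow> nat list \<Rightarrow> bool list \<Rightarrow> bool" where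
  "alive d k \<omega> 0 u \<eta> \<longleftrightarrow> True \<in> set \<eta>"
| "alive d k \<omega> (Suc n) u \<eta> \<longleftrightarrow>
     (\<exists>a\<in>{1..d}. alive d k \<omega> n (u @ [a]) (wet k \<omega> u a \<eta> # butlast \<eta>))"

text \<open>An entry may be \<open>True\<close> only if it refers to a genuine ancestor; otherwise
  \<^const>\<open>long_into\<close> could yield a long edge of the wrong length, outside \<^const>\<open>edges\<close>.\<close>

definition valid :: "nat \<Rightarrow> nat \<Rightarrow> nat list \<Rightarrow> bool list \<Rightarrow> bool" where
  "valid d k u \<eta> \<longleftrightarrow> u \<in> vertices d \<and> length \<eta> = k \<and> k \<ge> 1 \<and> (\<forall>i<k. \<eta> ! i \<longrightarrow> i \<le> length u)"

lemma valid_step: "valid d k u \<eta> \<Longrightarrow> a \<in> {1..d} \<Longrightarrow> valid d k (u @ [a]) (b # butlast \<eta>)"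
  by (auto simp: valid_def vertices_def nth_Cons nth_butlast split: nat.splits)

lemma Short_in_edges: "u \<in> vertices d \<Longrightarrow> a \<in> {1..d} \<Longrightarrow> Short u a \<in> edges d k"
  by (simp add: edges_def)

lemma long_into_in_edges:
  assumes "valid d k u \<eta>" "last \<eta>" "a \<in> {1..d}"
  shows "long_into k (u @ [a]) \<in> edges d k"
proof -
  define v where "v = u @ [a]"
  have "\<eta> ! (k - 1)" using assms by (auto simp: valid_def last_conv_nth simp flip: length_greater_0_conv)
  moreover have "k - 1 < k" "\<forall>i<k. \<eta> ! i \<longrightarrow> i \<le> length u" using assms by (auto simp: valid_def)
  ultimately have "k - 1 \<le> length u" by blast
  then have "k \<le> length v" by (simp add: v_def)
  moreover have "set v \<subseteq> {1..d}" using assms by (auto simp: v_def valid_def vertices_def)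
  then have "take m v \<in> lists {1..d}" "drop m v \<in> lists {1..d}" for m
    using set_take_subset[of m v] set_drop_subset[of m v] by (auto simp: lists_eq_set)
  ultimately show ?thesis
    unfolding edges_def long_into_def vertices_def v_def[symmetric] by simp
qed

text \<open>The split replaces a random state by two fixed ones, to which measurability and
  independence apply separately.\<close>

lemma alive_Cons_wet:
  "alive d k \<omega> n v (wet k \<omega> u a \<eta> # \<zeta>) \<longleftrightarrow>
    wet k \<omega> u a \<eta> \<and> alive d k \<omega> n v (True # \<zeta>) \<or> \<not> wet k \<omega> u a \<eta> \<and> alive d k \<omega> n v (False # \<zeta>)"
  by (cases "wet k \<omega> u a \<eta>") auto

lemma wet_cong:
  assumes "valid d k u \<eta>" "a \<in> {1..d}"
    and "\<And>e. e \<in> edges d k \<Longrightarrow> endpoint e = u @ [a] \<Longrightarrow> \<omega> e = \<omega>' e"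
  shows "wet k \<omega> u a \<eta> = wet k \<omega>' u a \<eta>"
  using assms Short_in_edges[of u d a k] long_into_in_edges[OF assms(1) _ assms(2)]
  by (auto simp: wet_def valid_def)

text \<open>Long edges that start above \<open>u\<close> and end below it count as part of the
  subtree; their sources matter only through \<open>\<eta>\<close>.\<close>

lemma alive_cong:
  assumes "valid d k u \<eta>"
    and "\<And>e w. e \<in> edges d k \<Longrightarrow> w \<noteq> [] \<Longrightarrow> endpoint e = u @ w \<Longrightarrow> \<omega> e = \<omega>' e"
  shows "alive d k \<omega> n u \<eta> = alive d k \<omega>' n u \<eta>"
  using assms
proof (induction n arbitrary: u \<eta>)
  case (Suc n)
  have "alive d k \<omega> n (u @ [a]) (b # butlast \<eta>) = alive d k \<omega>' n (u @ [a]) (b # butlast \<eta>)"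
    if "a \<in> {1..d}" for a b
    using Suc.prems that by (intro Suc.IH valid_step) auto
  moreover have "wet k \<omega> u a \<eta> = wet k \<omega>' u a \<eta>" if "a \<in> {1..d}" for a
    using Suc.prems that by (intro wet_cong) auto
  ultimately show ?case by simp
qed simp

lemma alive_Suc_imp:
  "\<eta> \<noteq> [] \<Longrightarrow> alive d k \<omega> (Suc n) u \<eta> \<Longrightarrow> alive d k \<omega> n u \<eta>"
proof (induction n arbitrary: u \<eta>)
  case 0
  have "True \<in> set \<eta>" if "hd \<eta> \<or> last \<eta>"
    using that hd_in_set[OF 0(1)] last_in_set[OF 0(1)] by (cases "hd \<eta>") simp_all
  then show ?case using 0(2) by (auto simp: wet_def dest: in_set_butlastD)
next
  case (Suc n)
  from Suc.prems(2) obtain a where "a \<in> {1..d}"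
    "alive d k \<omega> (Suc n) (u @ [a]) (wet k \<omega> u a \<eta> # butlast \<eta>)"
    by (auto simp only: alive.simps(2)[of d k \<omega> "Suc n" u \<eta>])
  then show ?case using Suc.IH[of "wet k \<omega> u a \<eta> # butlast \<eta>" "u @ [a]"] by auto
qed

locale percolation =
  fixes d k :: nat and p q :: real
  assumes k: "k \<ge> 1" and d: "d \<ge> 1" and pq: "0 \<le> p" "p \<le> 1" "0 \<le> q" "q \<le> 1"
begin

abbreviation "\<mu> \<equiv> perc_measure d k p q"
abbreviation "coord e \<equiv> measure_pmf (bernoulli_pmf (edge_prob p q e))"

interpretation product_prob_space coord "edges d k"
  by unfold_locales

lemma edges_nonempty: "edges d k \<noteq> {}"
  using Short_in_edges[of "[]" d 1 k] d by (auto simp: vertices_def)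

lemma coordinate_measurable: "e \<in> edges d k \<Longrightarrow> Measurable.pred \<mu> (\<lambda>\<omega>. \<omega> e)"
  unfolding perc_measure_def
  using measurable_component_singleton[of e "edges d k" coord] by simp

lemma prob_coordinate:
  assumes "e \<in> edges d k"
  shows "measure \<mu> {\<omega> \<in> space \<mu>. \<omega> e} = edge_prob p q e"
proof -
  have e: "0 \<le> edge_prob p q e" "edge_prob p q e \<le> 1"
    using pq by (auto simp: edge_prob_def split: edge.split)
  have "emeasure \<mu> {\<omega> \<in> space \<mu>. \<omega> e \<in> {True}} = emeasure (coord e) {True}"
    unfolding perc_measure_def using assms by (intro emeasure_PiM_Collect_single) auto
  then show ?thesis using e by (simp add: measure_def emeasure_pmf_single)
qed

lemma wet_measurable:
  assumes "valid d k u \<eta>" "a \<in> {1..d}"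
  shows "Measurable.pred \<mu> (\<lambda>\<omega>. wet k \<omega> u a \<eta>)"
proof -
  have [measurable]: "Measurable.pred \<mu> (\<lambda>\<omega>. \<omega> (Short u a))"
    using assms by (intro coordinate_measurable Short_in_edges) (auto simp: valid_def)
  have [measurable]: "Measurable.pred \<mu> (\<lambda>\<omega>. last \<eta> \<and> \<omega> (long_into k (u @ [a])))"
    using coordinate_measurable[OF long_into_in_edges[OF assms(1) _ assms(2)]] by (cases "last \<eta>") auto
  show ?thesis unfolding wet_def by measurable
qed

lemma alive_measurable:
  "valid d k u \<eta> \<Longrightarrow> Measurable.pred \<mu> (\<lambda>\<omega>. alive d k \<omega> n u \<eta>)"
proof (induction n arbitrary: u \<eta>)
  case (Suc n)
  have [measurable]: "Measurable.pred \<mu> (\<lambda>\<omega>. alive d k \<omega> n (u @ [a]) (b # butlast \<eta>))"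
    if "a \<in> {1..d}" for a b
    using Suc.prems that by (intro Suc.IH valid_step)
  have [measurable]: "Measurable.pred \<mu> (\<lambda>\<omega>. wet k \<omega> u a \<eta>)" if "a \<in> {1..d}" for a
    using Suc.prems that by (rule wet_measurable)
  show ?case
    unfolding alive.simps alive_Cons_wet by measurable
qed simp

interpretation prob: prob_space \<mu>
  unfolding perc_measure_def by (rule prob_space_axioms)

lemma prob_wet:
  assumes v: "valid d k u \<eta>" and a: "a \<in> {1..d}"
  shows "measure \<mu> {\<omega> \<in> space \<mu>. wet k \<omega> u a \<eta>} = wet_prob p q \<eta>"
proof -
  let ?s = "Short u a" and ?l = "long_into k (u @ [a])"
  have s: "?s \<in> edges d k" using v a by (intro Short_in_edges) (auto simp: valid_def)
  have l: "?l \<in> edges d k" if "last \<eta>" using long_into_in_edges[OF v that a] .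
  have [measurable]: "Measurable.pred \<mu> (\<lambda>\<omega>. \<omega> ?s)" using s by (rule coordinate_measurable)
  have [measurable]: "Measurable.pred \<mu> (\<lambda>\<omega>. last \<eta> \<and> \<omega> ?l)"
    using coordinate_measurable[OF l] by (cases "last \<eta>") auto
  have [measurable]: "Measurable.pred \<mu> (\<lambda>\<omega>. wet k \<omega> u a \<eta>)" using v a by (rule wet_measurable)
  have "measure \<mu> {\<omega> \<in> space \<mu>. \<not> (hd \<eta> \<and> \<omega> ?s) \<and> \<not> (last \<eta> \<and> \<omega> ?l)}
    = measure \<mu> {\<omega> \<in> space \<mu>. \<not> (hd \<eta> \<and> \<omega> ?s)} * measure \<mu> {\<omega> \<in> space \<mu>. \<not> (last \<eta> \<and> \<omega> ?l)}"
    unfolding perc_measure_def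
  \<comment> \<open>Without a True last entry the long edge may lie outside
    \<open>edges d k\<close>, hence the empty set. For \<open>k = 1\<close> the two edges join the
    same vertices but remain distinct coordinates.\<close>
  proof (rule prob_conj_disjoint_coordinates[OF edges_nonempty, of "{?s}" "if last \<eta> then {?l} else {}"],
      fold perc_measure_def)
    show "Measurable.pred \<mu> (\<lambda>\<omega>. \<not> (hd \<eta> \<and> \<omega> ?s))" by measurable
    show "Measurable.pred \<mu> (\<lambda>\<omega>. \<not> (last \<eta> \<and> \<omega> ?l))" by measurable
  qed (use s l in \<open>auto split: if_splits\<close>)
  moreover have "measure \<mu> {\<omega> \<in> space \<mu>. \<not> (hd \<eta> \<and> \<omega> ?s)} = 1 - (if hd \<eta> then p else 0)"
    using prob.prob_neg[of "\<lambda>\<omega>. hd \<eta> \<and> \<omega> ?s"] prob_coordinate[OF s] prob.prob_space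
    by (cases "hd \<eta>") (simp_all add: edge_prob_def)
  moreover have "measure \<mu> {\<omega> \<in> space \<mu>. \<not> (last \<eta> \<and> \<omega> ?l)} = 1 - (if last \<eta> then q else 0)"
    using prob.prob_neg[of "\<lambda>\<omega>. last \<eta> \<and> \<omega> ?l"] prob_coordinate[OF l] coordinate_measurable[OF l] prob.prob_space
    by (cases "last \<eta>") simp_all
  moreover have "measure \<mu> {\<omega> \<in> space \<mu>. \<not> wet k \<omega> u a \<eta>} = 1 - measure \<mu> {\<omega> \<in> space \<mu>. wet k \<omega> u a \<eta>}"
    by (intro prob.prob_neg) simp
  ultimately show ?thesis by (simp add: wet_prob_def wet_def)
qed

lemma prob_alive:
  "valid d k u \<eta> \<Longrightarrow> measure \<mu> {\<omega> \<in> space \<mu>. alive d k \<omega> n u \<eta>} = surv d p q n \<eta>"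
proof (induction n arbitrary: u \<eta>)
  case 0
  then show ?case by (simp add: prob.prob_space)
next
  case (Suc n)
  define Q where "Q a \<omega> \<longleftrightarrow> alive d k \<omega> n (u @ [a]) (wet k \<omega> u a \<eta> # butlast \<eta>)" for a \<omega>
  have am [measurable]: "Measurable.pred \<mu> (\<lambda>\<omega>. alive d k \<omega> n (u @ [a]) (b # butlast \<eta>))"
    if "a \<in> {1..d}" for a b
    using Suc.prems that by (intro alive_measurable valid_step)
  have wm [measurable]: "Measurable.pred \<mu> (\<lambda>\<omega>. wet k \<omega> u a \<eta>)" if "a \<in> {1..d}" for a
    using Suc.prems that by (rule wet_measurable)
  have Qm [measurable]: "Measurable.pred \<mu> (Q a)" if "a \<in> {1..d}" for a
    unfolding Q_def[abs_def] alive_Cons_wet using that by measurable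
  have prob_Q: "measure \<mu> {\<omega> \<in> space \<mu>. Q a \<omega>} = avg p q (surv d p q n) \<eta>" if a: "a \<in> {1..d}" for a
  proof -
    let ?W = "\<lambda>b \<omega>. wet k \<omega> u a \<eta> = b" and ?A = "\<lambda>b \<omega>. alive d k \<omega> n (u @ [a]) (b # butlast \<eta>)"
    \<comment> \<open>The update at \<open>u @ [a]\<close> uses edges ending there, later survival
      uses edges ending strictly below.\<close>
    have ind: "measure \<mu> {\<omega> \<in> space \<mu>. ?W b \<omega> \<and> ?A b \<omega>}
        = measure \<mu> {\<omega> \<in> space \<mu>. ?W b \<omega>} * measure \<mu> {\<omega> \<in> space \<mu>. ?A b \<omega>}" for b
      unfolding perc_measure_def
    proof (rule prob_conj_disjoint_coordinates[OF edges_nonempty,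
          of "{e \<in> edges d k. endpoint e = u @ [a]}"
             "{e \<in> edges d k. \<exists>w. w \<noteq> [] \<and> endpoint e = (u @ [a]) @ w}"], fold perc_measure_def)
      show "Measurable.pred \<mu> (?W b)" using wm[OF a] by measurable
      show "Measurable.pred \<mu> (?A b)" using am[OF a] .
      show "?W b \<omega> = ?W b \<omega>'"
        if "\<And>e. e \<in> {e \<in> edges d k. endpoint e = u @ [a]} \<Longrightarrow> \<omega> e = \<omega>' e" for \<omega> \<omega>'
        using wet_cong[OF Suc.prems a, of \<omega> \<omega>'] that by simp
      show "?A b \<omega> = ?A b \<omega>'"
        if "\<And>e. e \<in> {e \<in> edges d k. \<exists>w. w \<noteq> [] \<and> endpoint e = (u @ [a]) @ w} \<Longrightarrow> \<omega> e = \<omega>' e" for \<omega> \<omega>'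
        using alive_cong[OF valid_step[OF Suc.prems a], of \<omega> \<omega>' n b] that by simp
    qed auto
    have split: "{\<omega> \<in> space \<mu>. Q a \<omega>}
        = {\<omega> \<in> space \<mu>. ?W True \<omega> \<and> ?A True \<omega>} \<union> {\<omega> \<in> space \<mu>. ?W False \<omega> \<and> ?A False \<omega>}"
      unfolding Q_def alive_Cons_wet by auto
    have sum: "measure \<mu> {\<omega> \<in> space \<mu>. Q a \<omega>} = measure \<mu> {\<omega> \<in> space \<mu>. ?W True \<omega> \<and> ?A True \<omega>}
        + measure \<mu> {\<omega> \<in> space \<mu>. ?W False \<omega> \<and> ?A False \<omega>}"
      unfolding split using am[OF a] wm[OF a] by (intro prob.finite_measure_Union) auto
    have A: "measure \<mu> {\<omega> \<in> space \<mu>. ?A b \<omega>} = surv d p q n (b # butlast \<eta>)" for b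
      by (rule Suc.IH[OF valid_step[OF Suc.prems a]])
    have W: "measure \<mu> {\<omega> \<in> space \<mu>. ?W True \<omega>} = wet_prob p q \<eta>"
      "measure \<mu> {\<omega> \<in> space \<mu>. ?W False \<omega>} = 1 - wet_prob p q \<eta>"
      using prob.prob_neg[of "\<lambda>\<omega>. wet k \<omega> u a \<eta>"] prob_wet[OF Suc.prems a] wm[OF a] by simp_all
    show ?thesis unfolding sum ind[of True] ind[of False] A W avg_def ..
  qed
  \<comment> \<open>An endpoint lies below at most one child, so the lineages of the
    \<open>d\<close> children use disjoint sets of edges.\<close>
  have "measure \<mu> {\<omega> \<in> space \<mu>. \<forall>a\<in>{1..d}. \<not> Q a \<omega>} = (\<Prod>a\<in>{1..d}. measure \<mu> {\<omega> \<in> space \<mu>. \<not> Q a \<omega>})"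
    unfolding perc_measure_def
  proof (rule prob_all_disjoint_coordinates[OF _ _ edges_nonempty,
        where K = "\<lambda>a. {e \<in> edges d k. \<exists>w. endpoint e = (u @ [a]) @ w}"], fold perc_measure_def)
    fix a and \<omega> \<omega>' :: "edge \<Rightarrow> bool"
    assume a: "a \<in> {1..d}" and eq: "\<And>e. e \<in> {e \<in> edges d k. \<exists>w. endpoint e = (u @ [a]) @ w} \<Longrightarrow> \<omega> e = \<omega>' e"
    have "wet k \<omega> u a \<eta> = wet k \<omega>' u a \<eta>"
      using eq by (intro wet_cong[OF Suc.prems a]) auto
    moreover have "alive d k \<omega> n (u @ [a]) (b # butlast \<eta>) = alive d k \<omega>' n (u @ [a]) (b # butlast \<eta>)" for b
      using eq by (intro alive_cong[OF valid_step[OF Suc.prems a]]) auto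
    ultimately show "(\<not> Q a \<omega>) = (\<not> Q a \<omega>')" by (simp add: Q_def)
  qed (use d Qm in \<open>auto simp: disjoint_family_on_def\<close>)
  also have "\<dots> = (\<Prod>a\<in>{1..d}. 1 - avg p q (surv d p q n) \<eta>)"
    using prob_Q Qm by (intro prod.cong refl) (subst prob.prob_neg; simp)
  also have "\<dots> = (1 - avg p q (surv d p q n) \<eta>) ^ d" by simp
  finally have *: "measure \<mu> {\<omega> \<in> space \<mu>. \<forall>a\<in>{1..d}. \<not> Q a \<omega>} = (1 - avg p q (surv d p q n) \<eta>) ^ d" .
  have "{\<omega> \<in> space \<mu>. alive d k \<omega> (Suc n) u \<eta>} = {\<omega> \<in> space \<mu>. \<not> (\<forall>a\<in>{1..d}. \<not> Q a \<omega>)}"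
    by (auto simp: Q_def)
  also have "measure \<mu> \<dots> = 1 - measure \<mu> {\<omega> \<in> space \<mu>. \<forall>a\<in>{1..d}. \<not> Q a \<omega>}"
    by (intro prob.prob_neg) (use Qm in measurable)
  finally show ?case using * by simp
qed

end

section \<open>Reachability along rays as an instance of the state process\<close>

definition reach :: "nat \<Rightarrow> nat \<Rightarrow> (edge \<Rightarrow> bool) \<Rightarrow> nat list \<Rightarrow> bool" where
  "reach d k \<omega> v \<longleftrightarrow> ([], v) \<in> (open_rel d k \<omega>)\<^sup>*"

text \<open>The guard \<open>i \<le> length u\<close> matters: truncated subtraction would otherwise
  enter the root again for every level above it.\<close>

definition ray_state :: "nat \<Rightarrow> nat \<Rightarrow> (edge \<Rightarrow> bool) \<Rightarrow> nat list \<Rightarrow> bool list" where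
  "ray_state d k \<omega> u = map (\<lambda>i. i \<le> length u \<and> reach d k \<omega> (take (length u - i) u)) [0..<k]"

lemma open_rel_iff:
  "(u, v) \<in> open_rel d k \<omega> \<longleftrightarrow> u \<in> vertices d \<and>
    ((\<exists>a\<in>{1..d}. v = u @ [a] \<and> \<omega> (Short u a)) \<or> (\<exists>r\<in>lists {1..d}. length r = k \<and> v = u @ r \<and> \<omega> (Long u r)))"
  unfolding open_rel_def edges_def by auto

lemma reach_Nil: "reach d k \<omega> []"
  by (simp add: reach_def)

lemma reach_vertices: "reach d k \<omega> v \<Longrightarrow> v \<in> vertices d"
  unfolding reach_def
  by (induction rule: rtrancl_induct) (auto simp: open_rel_iff vertices_def)

lemma reach_snoc:
  assumes u: "u \<in> vertices d" "a \<in> {1..d}" and k: "k \<ge> 1"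
  shows "reach d k \<omega> (u @ [a]) \<longleftrightarrow> reach d k \<omega> u \<and> \<omega> (Short u a) \<or>
    k \<le> Suc (length u) \<and> reach d k \<omega> (take (Suc (length u) - k) u) \<and> \<omega> (long_into k (u @ [a]))"
    (is "_ \<longleftrightarrow> ?R")
proof
  assume "reach d k \<omega> (u @ [a])"
  then obtain w where w: "reach d k \<omega> w" "(w, u @ [a]) \<in> open_rel d k \<omega>"
    unfolding reach_def by (cases rule: rtranclE) auto
  then consider "w = u" "\<omega> (Short u a)"
    | r where "length r = k" "u @ [a] = w @ r" "\<omega> (Long w r)"
    by (auto simp: open_rel_iff)
  then show ?R
  proof cases
    case 2
    then have len: "Suc (length u) = length w + k"
      by (metis length_append length_append_singleton)
    have "w = take (length w) (u @ [a])" using 2 by simp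
    also have "\<dots> = take (length w) u" using len k by simp
    finally have "w = take (Suc (length u) - k) u" using len by simp
    moreover have "long_into k (u @ [a]) = Long w r"
      unfolding long_into_def 2(2) using 2(1) by simp
    ultimately show ?thesis using 2 w len by simp
  qed (use w in simp)
next
  assume ?R
  then show "reach d k \<omega> (u @ [a])"
  proof (elim disjE conjE)
    assume "reach d k \<omega> u" "\<omega> (Short u a)"
    then show ?thesis using u unfolding reach_def
      by (elim rtrancl_into_rtrancl) (auto simp: open_rel_iff)
  next
    let ?m = "Suc (length u) - k"
    assume *: "k \<le> Suc (length u)" "reach d k \<omega> (take ?m u)" "\<omega> (long_into k (u @ [a]))"
    let ?r = "drop ?m (u @ [a])"
    have take: "take ?m (u @ [a]) = take ?m u" using k by simp
    have "?r \<in> lists {1..d}"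
      using u set_drop_subset[of ?m "u @ [a]"] by (auto simp: vertices_def lists_eq_set)
    moreover have "u @ [a] = take ?m u @ ?r"
      unfolding take[symmetric] by (rule append_take_drop_id[symmetric])
    moreover have "length ?r = k" using * by simp
    moreover have "\<omega> (Long (take ?m u) ?r)"
      using *(3) unfolding long_into_def length_append_singleton take .
    ultimately have "(take ?m u, u @ [a]) \<in> open_rel d k \<omega>"
      using reach_vertices[OF *(2)] unfolding open_rel_iff by blast
    then show ?thesis using *(2) unfolding reach_def by (rule rtrancl_into_rtrancl[rotated])
  qed
qed

lemma ray_state_snoc:
  assumes "u \<in> vertices d" "a \<in> {1..d}" "k \<ge> 1"
  shows "ray_state d k \<omega> (u @ [a]) = wet k \<omega> u a (ray_state d k \<omega> u) # butlast (ray_state d k \<omega> u)"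
    (is "?l = ?r")
proof (rule nth_equalityI)
  show len: "length ?l = length ?r" using assms by (simp add: ray_state_def)
  fix i assume "i < length ?l"
  then have i: "i < k" by (simp add: ray_state_def)
  show "?l ! i = ?r ! i"
  proof (cases i)
    case 0
    \<comment> \<open>Entry \<open>k - 1\<close> at \<open>u\<close> sits \<open>k\<close> levels
      above \<open>u @ [a]\<close>, exactly at the source of the long edge into it.\<close>
    have "last (ray_state d k \<omega> u) \<longleftrightarrow> k - 1 \<le> length u \<and> reach d k \<omega> (take (length u - (k - 1)) u)"
      using assms by (simp add: ray_state_def last_conv_nth)
    also have "\<dots> \<longleftrightarrow> k \<le> Suc (length u) \<and> reach d k \<omega> (take (Suc (length u) - k) u)"
      using assms by (cases k) auto
    finally have last: "last (ray_state d k \<omega> u) \<longleftrightarrow> \<dots>" .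
    have "hd (ray_state d k \<omega> u) \<longleftrightarrow> reach d k \<omega> u"
      using assms by (simp add: ray_state_def hd_conv_nth)
    moreover have "?l ! 0 \<longleftrightarrow> reach d k \<omega> (u @ [a])" using i 0 by (simp add: ray_state_def)
    ultimately show ?thesis using 0 last reach_snoc[OF assms, of \<omega>] by (simp add: wet_def)
  next
    case (Suc j)
    then show ?thesis using i by (auto simp: ray_state_def nth_butlast)
  qed
qed

lemma ray_state_Nil: "k \<ge> 1 \<Longrightarrow> ray_state d k \<omega> [] = init_state k"
  by (rule nth_equalityI) (auto simp: ray_state_def reach_Nil nth_Cons split: nat.splits)

text \<open>With the true state as parameter, \<open>ray_state_snoc\<close> turns the recursion for
  \<open>alive\<close> into a search through level \<open>n\<close> below \<open>u\<close>.\<close>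

lemma alive_ray_state:
  assumes "k \<ge> 1"
  shows "u \<in> vertices d \<Longrightarrow> alive d k \<omega> n u (ray_state d k \<omega> u) \<longleftrightarrow>
    (\<exists>w\<in>vertices d. length w = n \<and> True \<in> set (ray_state d k \<omega> (u @ w)))"
proof (induction n arbitrary: u)
  case 0
  then show ?case by (auto simp: vertices_def)
next
  case (Suc n)
  have "alive d k \<omega> (Suc n) u (ray_state d k \<omega> u) \<longleftrightarrow>
      (\<exists>a\<in>{1..d}. alive d k \<omega> n (u @ [a]) (ray_state d k \<omega> (u @ [a])))"
    using ray_state_snoc[OF Suc.prems _ assms] by simp
  also have "\<dots> \<longleftrightarrow>
      (\<exists>a\<in>{1..d}. \<exists>w\<in>vertices d. length w = n \<and> True \<in> set (ray_state d k \<omega> ((u @ [a]) @ w)))"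
    using Suc.prems by (intro bex_cong refl Suc.IH) (auto simp: vertices_def)
  also have "\<dots> \<longleftrightarrow> (\<exists>w\<in>vertices d. length w = Suc n \<and> True \<in> set (ray_state d k \<omega> (u @ w)))"
  proof (intro iffI; elim bexE conjE)
    fix a w assume "a \<in> {1..d}" "w \<in> vertices d" "length w = n" "True \<in> set (ray_state d k \<omega> ((u @ [a]) @ w))"
    then show "\<exists>w\<in>vertices d. length w = Suc n \<and> True \<in> set (ray_state d k \<omega> (u @ w))"
      by (intro bexI[of _ "a # w"]) (auto simp: vertices_def)
  next
    fix w assume "w \<in> vertices d" "length w = Suc n" "True \<in> set (ray_state d k \<omega> (u @ w))"
    then show "\<exists>a\<in>{1..d}. \<exists>w\<in>vertices d. length w = n \<and> True \<in> set (ray_state d k \<omega> ((u @ [a]) @ w))"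
      by (cases w) (auto simp: vertices_def)
  qed
  finally show ?case .
qed

text \<open>No edge spans more than \<open>k\<close> levels, so an open path to \<open>v\<close>
  cannot jump over \<open>k\<close> consecutive ancestors.\<close>

lemma reach_near:
  assumes "reach d k \<omega> v" "n \<le> length v" "k \<ge> 1"
  shows "\<exists>i<k. i \<le> n \<and> reach d k \<omega> (take (n - i) v)"
  using assms(1)[unfolded reach_def] assms(2)
proof (induction rule: rtrancl_induct)
  case base
  then show ?case using assms by (auto simp: reach_Nil)
next
  case (step u v)
  then obtain r where r: "v = u @ r" "length r = 1 \<or> length r = k"
    by (auto simp: open_rel_iff)
  have v: "reach d k \<omega> v" and u: "reach d k \<omega> u"
    using step by (auto simp: reach_def)
  have "n \<le> length u \<or> n = length v \<or> n > length u \<and> length r = k \<and> n < length v"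
    using step.prems r by auto
  then consider "n \<le> length u" | "n = length v" | "n > length u" "length r = k" "n < length v"
    by blast
  then show ?case
  proof cases
    case 1
    with step.IH obtain i where "i < k" "i \<le> n" "reach d k \<omega> (take (n - i) u)" by auto
    then show ?thesis using r 1 by (intro exI[of _ i]) auto
  next
    case 2
    then show ?thesis using v assms by (intro exI[of _ 0]) auto
  next
    case 3
    then show ?thesis using u r by (intro exI[of _ "n - length u"]) auto
  qed
qed

lemma finite_vertices_upto: "finite {v \<in> vertices d. length v \<le> n}"
proof -
  have "{v \<in> vertices d. length v \<le> n} = {xs. set xs \<subseteq> {1..d} \<and> length xs \<le> n}"
    by (auto simp: vertices_def)
  then show ?thesis using finite_lists_length_le[of "{1..d}" n] by simp
qed

text \<open>Since only finitely many vertices have bounded length, infinitely many reached vertices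
  means reached vertices of unbounded length, and \<open>reach_near\<close> makes these visible in
  the state at every level.\<close>

lemma percolates_iff_alive:
  assumes k: "k \<ge> 1"
  shows "percolates d k \<omega> \<longleftrightarrow> (\<forall>n. alive d k \<omega> n [] (init_state k))"
proof -
  have alive: "alive d k \<omega> n [] (init_state k) \<longleftrightarrow>
      (\<exists>w\<in>vertices d. length w = n \<and> (\<exists>i<k. i \<le> n \<and> reach d k \<omega> (take (n - i) w)))" for n
  proof -
    have "True \<in> set (ray_state d k \<omega> w) \<longleftrightarrow>
        (\<exists>i<k. i \<le> length w \<and> reach d k \<omega> (take (length w - i) w))" for w
      by (auto simp: ray_state_def)
    then show ?thesis
      using alive_ray_state[OF k, of "[]" d \<omega> n] unfolding ray_state_Nil[OF k]
      by (auto simp: vertices_def)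
  qed
  have perc: "percolates d k \<omega> \<longleftrightarrow> infinite {v. reach d k \<omega> v}"
    by (simp add: percolates_def reach_def)
  show ?thesis
  proof
    assume "percolates d k \<omega>"
    show "\<forall>n. alive d k \<omega> n [] (init_state k)"
    proof
      fix n
      have "\<not> {v. reach d k \<omega> v} \<subseteq> {v \<in> vertices d. length v \<le> n}"
        using \<open>percolates d k \<omega>\<close> perc finite_vertices_upto finite_subset by blast
      then obtain v where v: "reach d k \<omega> v" "n \<le> length v"
        using reach_vertices by fastforce
      have "take n v \<in> vertices d"
        using reach_vertices[OF v(1)] set_take_subset[of n v] by (auto simp: vertices_def)
      then show "alive d k \<omega> n [] (init_state k)"
        unfolding alive using reach_near[OF v k] v(2) by (intro bexI[of _ "take n v"]) auto
    qed
  next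
    assume all: "\<forall>n. alive d k \<omega> n [] (init_state k)"
    show "percolates d k \<omega>"
      unfolding perc
    proof
      assume "finite {v. reach d k \<omega> v}"
      then have "finite (length ` {v. reach d k \<omega> v})" by simp
      then obtain N where N: "\<And>v. reach d k \<omega> v \<Longrightarrow> length v \<le> N"
        unfolding finite_nat_set_iff_bounded_le by auto
      \<comment> \<open>A state looks back at most \<open>k - 1\<close> levels, so level
        \<open>N + k\<close> exhibits a reached vertex longer than \<open>N\<close>.\<close>
      obtain w i where "length w = N + k" "i < k" "reach d k \<omega> (take (N + k - i) w)"
        using all[rule_format, of "N + k"] unfolding alive by auto
      then show False using N[of "take (N + k - i) w"] by simp
    qed
  qed
qed

context percolation
begin

lemma valid_init_state: "valid d k [] (init_state k)"
  using k by (auto simp: valid_def vertices_def nth_Cons split: nat.splits)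

lemma perc_prob_eq_lim: "(\<lambda>n. surv d p q n (init_state k)) \<longlonglongrightarrow> perc_prob d k p q"
proof -
  interpret prob: prob_space \<mu>
    unfolding perc_measure_def by (intro prob_space_PiM measure_pmf.prob_space_axioms)
  define A where "A n = {\<omega> \<in> space \<mu>. alive d k \<omega> n [] (init_state k)}" for n
  have "A n \<in> sets \<mu>" for n
    unfolding A_def using alive_measurable[OF valid_init_state] by measurable
  moreover have "decseq A"
    unfolding A_def using alive_Suc_imp[of "init_state k" d k] by (intro decseq_SucI) blast
  ultimately have "(\<lambda>n. measure \<mu> (A n)) \<longlonglongrightarrow> measure \<mu> (\<Inter>n. A n)"
    by (intro prob.finite_Lim_measure_decseq) auto
  moreover have "measure \<mu> (A n) = surv d p q n (init_state k)" for n
    unfolding A_def by (rule prob_alive[OF valid_init_state])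
  moreover have "(\<Inter>n. A n) = {\<omega> \<in> space \<mu>. percolates d k \<omega>}"
    unfolding A_def percolates_iff_alive[OF k] by auto
  ultimately show ?thesis by (simp add: perc_prob_def)
qed

text \<open>A positive limit of a decreasing sequence is itself a uniform lower bound. In this form
  membership in the region involves no measure.\<close>

lemma perc_prob_pos_iff: "perc_prob d k p q > 0 \<longleftrightarrow> (\<exists>a>0. \<forall>n. a \<le> surv d p q n (init_state k))"
proof
  assume "perc_prob d k p q > 0"
  moreover have "decseq (\<lambda>n. surv d p q n (init_state k))"
    using surv_decseq[OF pq] d by (intro decseq_SucI) simp
  then have "perc_prob d k p q \<le> surv d p q n (init_state k)" for n
    using decseq_ge[OF _ perc_prob_eq_lim] by blast
  ultimately show "\<exists>a>0. \<forall>n. a \<le> surv d p q n (init_state k)" by blast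
next
  assume "\<exists>a>0. \<forall>n. a \<le> surv d p q n (init_state k)"
  then obtain a where a: "a > 0" "\<And>n. a \<le> surv d p q n (init_state k)" by blast
  then have "a \<le> perc_prob d k p q" using LIMSEQ_le_const[OF perc_prob_eq_lim] by blast
  then show "perc_prob d k p q > 0" using a by linarith
qed

end

section \<open>Extreme parameters and the strict inequality\<close>

lemma surv_long_open:
  assumes "0 \<le> p" "p \<le> 1" "d \<ge> 1"
  shows "\<eta> \<noteq> [] \<Longrightarrow> True \<in> set \<eta> \<Longrightarrow> surv d p 1 n \<eta> = 1"
proof (induction n arbitrary: \<eta>)
  case (Suc n)
  have "avg p 1 (surv d p 1 n) \<eta> = 1"
  proof (cases "last \<eta>")
    case True
    then show ?thesis using Suc.IH[of "True # butlast \<eta>"] by (simp add: avg_def wet_prob_def)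
  next
    case False
    then have "True \<in> set (butlast \<eta>)"
      using Suc.prems by (cases \<eta> rule: rev_cases) auto
    then show ?thesis using Suc.IH[of "_ # butlast \<eta>"] by (simp add: avg_def)
  qed
  then show ?case using assms by simp
qed simp

lemma surv_short_open:
  assumes "0 \<le> q" "q \<le> 1" "d \<ge> 1"
  shows "hd \<eta> \<Longrightarrow> \<eta> \<noteq> [] \<Longrightarrow> surv d 1 q n \<eta> = 1"
proof (induction n arbitrary: \<eta>)
  case (Suc n)
  have "avg 1 q (surv d 1 q n) \<eta> = 1"
    using Suc.prems Suc.IH[of "True # butlast \<eta>"] by (simp add: avg_def wet_prob_def)
  then show ?case using assms by simp
qed (use hd_in_set in force)

theorem theorem1:
  fixes d k :: nat and p :: real
  assumes "d \<ge> 2" and "k \<ge> 1" and "0 \<le> p" and "p \<le> 1"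
    and "q_c d p k \<noteq> 0"
  shows "q_c d p (Suc k) < q_c d p k"
proof -
  have region: "(p, q) \<in> perc_region d m \<longleftrightarrow>
      0 \<le> q \<and> q \<le> 1 \<and> (\<exists>a>0. \<forall>n. a \<le> surv d p q n (init_state m))" if "m \<ge> 1" for m q
  proof (cases "0 \<le> q \<and> q \<le> 1")
    case True
    then interpret percolation d m p q using assms that by unfold_locales auto
    show ?thesis using perc_prob_pos_iff True assms by (simp add: perc_region_def)
  qed (auto simp: perc_region_def)
  \<comment> \<open>At \<open>q = 1\<close> any True entry is passed on until it opens a long edge.
    The set under the infimum is thus nonempty.\<close>
  have one: "(p, 1) \<in> perc_region d k"
    using assms surv_long_open[of p d "init_state k"] unfolding region[OF \<open>k \<ge> 1\<close>]
    by (auto intro!: exI[of _ 1])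
  have bdd: "bdd_below {q. (p, q) \<in> perc_region d m}" for m
    by (rule bdd_belowI[of _ 0]) (simp add: perc_region_def)
  define q\<^sub>0 where "q\<^sub>0 = q_c d p k"
  have "0 \<le> q\<^sub>0"
    unfolding q\<^sub>0_def q_c_def using one by (intro cInf_greatest) (auto simp: perc_region_def)
  then have q0: "0 < q\<^sub>0" using assms(5) by (simp add: q\<^sub>0_def)
  \<comment> \<open>For \<open>p = 1\<close> an open ray exists already at \<open>q = 0\<close>,
    which would make the critical value 0.\<close>
  have "p < 1"
  proof (rule ccontr)
    assume "\<not> p < 1"
    then have "(p, 0) \<in> perc_region d k"
      using assms surv_short_open[of 0 d "init_state k"] unfolding region[OF \<open>k \<ge> 1\<close>]
      by (auto intro!: exI[of _ 1])
    then have "q\<^sub>0 \<le> 0" unfolding q\<^sub>0_def q_c_def using bdd by (intro cInf_lower) auto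
    then show False using q0 by simp
  qed
  with surv_longer[OF assms(1,2,3) _ q0] obtain r where r: "r > 1"
    and longer: "\<And>q a. q\<^sub>0 \<le> q \<Longrightarrow> q < r * q\<^sub>0 \<Longrightarrow> q \<le> 1 \<Longrightarrow> 0 < a \<Longrightarrow>
      (\<And>n. a \<le> surv d p q n (init_state k)) \<Longrightarrow>
      \<exists>b>0. \<forall>n. b \<le> surv d p (q\<^sub>0 / r) n (init_state (Suc k))"
    by metis
  \<comment> \<open>The infimum leaves some \<open>q\<close> of the region in the window from
    \<open>q\<^sub>0\<close> to \<open>r * q\<^sub>0\<close>, as \<open>longer\<close>
    demands.\<close>
  have "q\<^sub>0 < r * q\<^sub>0" using r q0 by simp
  then have "\<exists>q\<in>{q. (p, q) \<in> perc_region d k}. q < r * q\<^sub>0"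
    unfolding q\<^sub>0_def q_c_def using one bdd by (intro cInf_lessD) auto
  then obtain q where q: "(p, q) \<in> perc_region d k" "q < r * q\<^sub>0" by blast
  have "q\<^sub>0 \<le> q" unfolding q\<^sub>0_def q_c_def using q bdd by (intro cInf_lower) auto
  then have "\<exists>b>0. \<forall>n. b \<le> surv d p (q\<^sub>0 / r) n (init_state (Suc k))"
    using q longer unfolding region[OF \<open>k \<ge> 1\<close>] by blast
  moreover have "q\<^sub>0 \<le> 1" unfolding q\<^sub>0_def q_c_def using one bdd by (intro cInf_lower) auto
  moreover have less: "q\<^sub>0 / r < q\<^sub>0" using q0 r by (simp add: field_simps)
  ultimately have "(p, q\<^sub>0 / r) \<in> perc_region d (Suc k)"
    using q0 r unfolding region[of "Suc k", simplified] by auto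
  then have "q_c d p (Suc k) \<le> q\<^sub>0 / r" unfolding q_c_def using bdd by (intro cInf_lower) auto
  with less show ?thesis by (simp add: q\<^sub>0_def)
qed

end
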